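(* Let $k$ be an ordinary differential field of characteristic zero, $R=k\{y_1,\ldots,y_l\}$, and let $P\subsetneq R$ be a prime differential ideal of order $h$. Let $>$ be an arbitrary ranking. Then there exists a (Kolchin) characteristic set $\mathbb{C}=C_1,\ldots,C_n$ of $P$ with respect to $>$ such that $\operatorname{ord}(C_i,y_t)\le h$ for all $1\le i\le n$ and all $1\le t\le l$.
   Context: $k$ is a differential field of characteristic zero with one derivation $\delta$; $R=k\{y_1,\dots,y_l\}$ is the polynomial ring over $k$ in the derivatives $y_j^{(r)}=\delta^r y_j$; the order of $y_j^{(r)}$ is $r$. For $f\in R$, $\operatorname{ord}f$ is the maximal order of a derivative appearing in $f$ and $\operatorname{ord}(f,y_t)$ is the maximal order of a derivative of $y_t$ appearing in $f$. A ranking is a total order on the derivatives with $\theta u\ge u$ and $u\ge v\Rightarrow \theta u\ge\theta v$ for derivative operators $\theta$; it is orderly if $\operatorname{ord}u>\operatorname{ord}v$ implies $u>v$. For $f\notin k$: leader $u_f$ = highest ranked derivative in $f$; initial $I_f$ = leading coefficient of $f$ in $u_f$. $f$ is reduced w.r.t. $g$ if no proper derivative of $u_g$ appears in $f$ and $\deg_{u_g}f<\deg_{u_g}g$. An autoreduced set is a set disjoint from $k$ each of whose elements is reduced w.r.t. the others; elements are listed in increasing rank ($f<g$ if $u_f<u_g$, or same leader and smaller degree), and autoreduced sets are compared lexicographically, a proper extension having lower rank. A (Kolchin) characteristic set of a differential ideal is an autoreduced subset of it of lowest rank. For an autoreduced set $\mathbb{A}=A_1,\dots,A_p$, $\operatorname{ord}\mathbb{A}=\sum_i\operatorname{ord}A_i$.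 The order of a prime differential ideal $P$ is $\operatorname{ord}\mathbb{C}$ for a characteristic set $\mathbb{C}$ of $P$ w.r.t. an orderly ranking. *)

theory Defs
  imports Main "HOL-Library.Poly_Mapping"
begin

text \<open>A derivative y_j^(r) is encoded as the pair (j, r); the differential indeterminates
  y_1, ..., y_l are encoded by the indices j = 0, ..., l - 1.  A differential polynomial is a
  finitely supported map from monomials (finitely supported exponent vectors on derivatives)
  to coefficients in k.\<close>

type_synonym dvar = "nat \<times> nat"
type_synonym 'k dpoly = "(dvar \<Rightarrow>\<^sub>0 nat) \<Rightarrow>\<^sub>0 'k"

definition is_derivation :: "('k::field_char_0 \<Rightarrow> 'k) \<Rightarrow> bool" where
  "is_derivation \<delta> \<longleftrightarrow> (\<forall>a b. \<delta> (a + b) = \<delta> a + \<delta> b) \<and> (\<forall>a b. \<delta> (a * b) = a * \<delta> b + \<delta> a * b)"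

definition dshift :: "dvar \<Rightarrow> dvar" where
  "dshift v = (fst v, Suc (snd v))"

definition dvars :: "'k::zero dpoly \<Rightarrow> dvar set" where
  "dvars f = (\<Union>m\<in>Poly_Mapping.keys f. Poly_Mapping.keys (m :: dvar \<Rightarrow>\<^sub>0 nat))"

definition dring :: "nat \<Rightarrow> 'k::zero dpoly set" where
  "dring l = {f. \<forall>v\<in>dvars f. fst v < l}"

definition is_const :: "'k::zero dpoly \<Rightarrow> bool" where
  "is_const f \<longleftrightarrow> dvars f = {}"

text \<open>The derivation on R extending \<delta>, with \<delta>(y_j^(r)) = y_j^(r+1).\<close>
definition dderiv :: "('k::field_char_0 \<Rightarrow> 'k) \<Rightarrow> 'k dpoly \<Rightarrow> 'k dpoly" where
  "dderiv \<delta> f = (\<Sum>m\<in>Poly_Mapping.keys f. Poly_Mapping.single m (\<delta> (Poly_Mapping.lookup f m))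
      + (\<Sum>v\<in>Poly_Mapping.keys m. Poly_Mapping.single
            (m - Poly_Mapping.single v 1 + Poly_Mapping.single (dshift v) 1)
            (of_nat (Poly_Mapping.lookup m v) * Poly_Mapping.lookup f m)))"

definition diff_ideal :: "('k::field_char_0 \<Rightarrow> 'k) \<Rightarrow> nat \<Rightarrow> 'k dpoly set \<Rightarrow> bool" where
  "diff_ideal \<delta> l P \<longleftrightarrow> P \<subseteq> dring l \<and> 0 \<in> P
     \<and> (\<forall>f\<in>P. \<forall>g\<in>P. f + g \<in> P)
     \<and> (\<forall>f\<in>P. \<forall>g\<in>dring l. g * f \<in> P)
     \<and> (\<forall>f\<in>P. dderiv \<delta> f \<in> P)"

definition prime_diff_ideal :: "('k::field_char_0 \<Rightarrow> 'k) \<Rightarrow> nat \<Rightarrow> 'k dpoly set \<Rightarrow> bool" where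
  "prime_diff_ideal \<delta> l P \<longleftrightarrow> diff_ideal \<delta> l P \<and> P \<noteq> dring l
     \<and> (\<forall>f\<in>dring l. \<forall>g\<in>dring l. f * g \<in> P \<longrightarrow> f \<in> P \<or> g \<in> P)"

text \<open>A ranking is given by its non-strict relation rk u v meaning u \<le> v, a total order on the
  derivatives of y_1..y_l with \<theta>u \<ge> u and u \<le> v \<Longrightarrow> \<theta>u \<le> \<theta>v (it suffices to take \<theta> = \<delta>).\<close>

definition dvars_of :: "nat \<Rightarrow> dvar set" where
  "dvars_of l = {v. fst v < l}"

definition ranking :: "nat \<Rightarrow> (dvar \<Rightarrow> dvar \<Rightarrow> bool) \<Rightarrow> bool" where
  "ranking l rk \<longleftrightarrow>
     (\<forall>u\<in>dvars_of l. rk u u)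
   \<and> (\<forall>u\<in>dvars_of l. \<forall>v\<in>dvars_of l. rk u v \<and> rk v u \<longrightarrow> u = v)
   \<and> (\<forall>u\<in>dvars_of l. \<forall>v\<in>dvars_of l. \<forall>w\<in>dvars_of l. rk u v \<and> rk v w \<longrightarrow> rk u w)
   \<and> (\<forall>u\<in>dvars_of l. \<forall>v\<in>dvars_of l. rk u v \<or> rk v u)
   \<and> (\<forall>u\<in>dvars_of l. rk u (dshift u))
   \<and> (\<forall>u\<in>dvars_of l. \<forall>v\<in>dvars_of l. rk u v \<longrightarrow> rk (dshift u) (dshift v))"

definition orderly :: "nat \<Rightarrow> (dvar \<Rightarrow> dvar \<Rightarrow> bool) \<Rightarrow> bool" where
  "orderly l rk \<longleftrightarrow> (\<forall>u\<in>dvars_of l. \<forall>v\<in>dvars_of l. snd u > snd v \<longrightarrow> rk v u \<and> u \<noteq> v)"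

definition leader :: "(dvar \<Rightarrow> dvar \<Rightarrow> bool) \<Rightarrow> 'k::zero dpoly \<Rightarrow> dvar" where
  "leader rk f = (THE u. u \<in> dvars f \<and> (\<forall>w\<in>dvars f. rk w u))"

definition deg_in :: "dvar \<Rightarrow> 'k::zero dpoly \<Rightarrow> nat" where
  "deg_in u f = Max (insert 0 ((\<lambda>m. Poly_Mapping.lookup m u) ` Poly_Mapping.keys f))"

text \<open>f is reduced with respect to g (g not in k).\<close>
definition reduced :: "(dvar \<Rightarrow> dvar \<Rightarrow> bool) \<Rightarrow> 'k::zero dpoly \<Rightarrow> 'k dpoly \<Rightarrow> bool" where
  "reduced rk f g \<longleftrightarrow>
     (\<forall>s>0. (fst (leader rk g), snd (leader rk g) + s) \<notin> dvars f)
   \<and> deg_in (leader rk g) f < deg_in (leader rk g) g"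

definition poly_less :: "(dvar \<Rightarrow> dvar \<Rightarrow> bool) \<Rightarrow> 'k::zero dpoly \<Rightarrow> 'k dpoly \<Rightarrow> bool" where
  "poly_less rk f g \<longleftrightarrow>
     (rk (leader rk f) (leader rk g) \<and> leader rk f \<noteq> leader rk g)
   \<or> (leader rk f = leader rk g \<and> deg_in (leader rk f) f < deg_in (leader rk g) g)"

definition same_rank :: "(dvar \<Rightarrow> dvar \<Rightarrow> bool) \<Rightarrow> 'k::zero dpoly \<Rightarrow> 'k dpoly \<Rightarrow> bool" where
  "same_rank rk f g \<longleftrightarrow> leader rk f = leader rk g \<and> deg_in (leader rk f) f = deg_in (leader rk g) g"

definition autoreduced :: "nat \<Rightarrow> (dvar \<Rightarrow> dvar \<Rightarrow> bool) \<Rightarrow> 'k::zero dpoly list \<Rightarrow> bool" where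
  "autoreduced l rk A \<longleftrightarrow>
     set A \<subseteq> dring l \<and> (\<forall>f\<in>set A. \<not> is_const f)
   \<and> (\<forall>i<length A. \<forall>j<length A. i \<noteq> j \<longrightarrow> reduced rk (A ! i) (A ! j))
   \<and> (\<forall>i j. i < j \<and> j < length A \<longrightarrow> poly_less rk (A ! i) (A ! j))"

definition aset_less :: "(dvar \<Rightarrow> dvar \<Rightarrow> bool) \<Rightarrow> 'k::zero dpoly list \<Rightarrow> 'k dpoly list \<Rightarrow> bool" where
  "aset_less rk A B \<longleftrightarrow>
     (\<exists>i<min (length A) (length B). (\<forall>j<i. same_rank rk (A ! j) (B ! j)) \<and> poly_less rk (A ! i) (B ! i))
   \<or> (length A > length B \<and> (\<forall>j<length B. same_rank rk (A ! j) (B ! j)))"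

definition char_set :: "nat \<Rightarrow> (dvar \<Rightarrow> dvar \<Rightarrow> bool) \<Rightarrow> 'k::zero dpoly set \<Rightarrow> 'k dpoly list \<Rightarrow> bool" where
  "char_set l rk P C \<longleftrightarrow> autoreduced l rk C \<and> set C \<subseteq> P
     \<and> \<not> (\<exists>B. autoreduced l rk B \<and> set B \<subseteq> P \<and> aset_less rk B C)"

definition dord :: "'k::zero dpoly \<Rightarrow> nat" where
  "dord f = Max (snd ` dvars f)"

definition dord_var :: "'k::zero dpoly \<Rightarrow> nat \<Rightarrow> nat" where
  "dord_var f t = Max (insert 0 {r. (t, r) \<in> dvars f})"

definition aset_ord :: "'k::zero dpoly list \<Rightarrow> nat" where
  "aset_ord A = sum_list (map dord A)"

text \<open>Order of a prime differential ideal: the order of a characteristic set of P w.r.t. an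
  orderly ranking (independent of the choice).\<close>
definition ideal_order :: "nat \<Rightarrow> 'k::zero dpoly set \<Rightarrow> nat \<Rightarrow> bool" where
  "ideal_order l P h \<longleftrightarrow> (\<exists>rk C. ranking l rk \<and> orderly l rk \<and> char_set l rk P C \<and> aset_ord C = h)"

end

theory Submission
  imports Defs
begin

text \<open>
  In characteristic zero algebraic dependence modulo P can be read off the differentials: over the
  fraction field of R/P, the differentials of the derivatives span a vector space whose relations are
  generated by the gradients of the elements of P.  Differentiation acts on these relations.  For a
  characteristic set of P with respect to any ranking, Ritt reduction shows that the derivatives B
  that are not derivatives of leaders form a basis.

  Counting independent derivatives of order at most s, and comparing with an orderly ranking, where
  the count is at most d (s + 1) + h with d the differential dimension, shows that the leaders have
  order at most h, and that each of them depends on elements of B of order at most h: if e > h were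
  the least bound for the orders needed, differentiating the relation of some leader (j, r) would make
  e - r of its derivatives independent of the elements of B of order at most e.

  Hence the elements of B of order above h are algebraically independent over the remaining
  derivatives in a characteristic set, so the coefficients of its members with respect to them lie in
  P.  Replacing each member by such a coefficient of full degree in the leader bounds all orders.
\<close>

section \<open>Partial derivatives and the derivation on differential polynomials\<close>

text \<open>No fraction field is built: relations are vectors over R, a coefficient counts as
  nonzero when it lies outside P, and primality lets cross-multiplication replace division. Working
  with differentials makes dependence linear and makes the effect of differentiating a relation
  visible on its coefficients. The obstacle is that, for an arbitrary ranking, the nonleading
  derivatives in a relation may have orders unrelated to the leader. Comparing cardinalities bounds
  only the sum of the orders of the leaders. The remaining orders are controlled through minimality
  of e: an element of B of order e > h belongs to an indeterminate without a leader, because all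
  leaders have order at most h. Its derivatives therefore never leave B, and the i-th derivative of
  the relation allows the one of order e + i to be exchanged for (j, r + i). This is profitable as
  long as r + i \<le> e, which explains the number e - r. The count then says that the orders of the
  leaders plus e - r sum to at most h; as r is one of those orders, e \<le> h.\<close>

lemma poly_mapping_add_induct [case_names single add]:
  assumes "\<And>m c. Q (Poly_Mapping.single m c)" and "\<And>f g. Q f \<Longrightarrow> Q g \<Longrightarrow> Q (f + g)"
  shows "Q (f :: 'a \<Rightarrow>\<^sub>0 'b::monoid_add)"
proof (induction f rule: Poly_Mapping.update_induct)
  case const
  show ?case using assms(1)[of undefined 0] by simp
next
  case (update f a b)
  have "Poly_Mapping.update a b f = f + Poly_Mapping.single a b"
    using update(1)
    by (intro poly_mapping_eqI) (auto simp: lookup_update lookup_add lookup_single in_keys_iff when_def)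
  then show ?case using assms update by metis
qed

definition X :: "dvar \<Rightarrow> 'k::field_char_0 dpoly" where
  "X v = Poly_Mapping.single (Poly_Mapping.single v 1) 1"

definition const :: "'k::field_char_0 \<Rightarrow> 'k dpoly" where
  "const c = Poly_Mapping.single 0 c"

lemma dpoly_induct [case_names const X add mult]:
  fixes f :: "'k::field_char_0 dpoly"
  assumes c: "\<And>c. Q (const c)" and x: "\<And>v. Q (X v)"
    and a: "\<And>f g. Q f \<Longrightarrow> Q g \<Longrightarrow> Q (f + g)" and t: "\<And>f g. Q f \<Longrightarrow> Q g \<Longrightarrow> Q (f * g)"
  shows "Q f"
proof (induction f rule: poly_mapping_add_induct)
  case (single m c)
  have "Q (Poly_Mapping.single m 1)"
  proof (induction m rule: poly_mapping_add_induct)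
    case (single v n)
    show ?case
    proof (induction n)
      case 0
      show ?case using c[of 1] by (simp add: const_def)
    next
      case (Suc n)
      have "Poly_Mapping.single (Poly_Mapping.single v (Suc n)) (1::'k)
          = X v * Poly_Mapping.single (Poly_Mapping.single v n) 1"
        unfolding X_def mult_single single_add[symmetric] by simp
      then show ?case using t[OF x Suc] by simp
    qed
  next
    case (add f g)
    then show ?case using t[OF add] by (simp add: mult_single)
  qed
  from t[OF c[of c] this] show ?case by (simp add: const_def mult_single)
qed (use a in blast)

text \<open>Used to identify commutators of derivations: constants and variables generate the ring,
  and the Leibniz rule carries agreement through products.\<close>

lemma derivation_eqI:
  fixes D E :: "'k::field_char_0 dpoly \<Rightarrow> 'k dpoly"
  assumes "\<And>c. D (const c) = E (const c)" "\<And>v. D (X v) = E (X v)"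
    "\<And>f g. D (f + g) = D f + D g" "\<And>f g. D (f * g) = D f * g + f * D g"
    "\<And>f g. E (f + g) = E f + E g" "\<And>f g. E (f * g) = E f * g + f * E g"
  shows "D f = E f"
  by (induction f rule: dpoly_induct) (simp_all add: assms)

text \<open>The formal partial derivative. Subtraction of exponents is truncated, but a monomial
  free of v gets the factor 0, so a wrong exponent never shows.\<close>

definition pd :: "dvar \<Rightarrow> 'k::field_char_0 dpoly \<Rightarrow> 'k dpoly" where
  "pd v f = (\<Sum>m\<in>Poly_Mapping.keys f. Poly_Mapping.single (m - Poly_Mapping.single v 1)
     (of_nat (Poly_Mapping.lookup m v) * Poly_Mapping.lookup f m))"

lemma pd_add: "pd v (f + g) = pd v f + pd v g"
  unfolding pd_def by (rule setsum_keys_plus_distrib) (simp_all add: algebra_simps single_add)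

lemma pd_single: "pd v (Poly_Mapping.single m c)
    = Poly_Mapping.single (m - Poly_Mapping.single v 1) (of_nat (Poly_Mapping.lookup m v) * c)"
  by (simp add: pd_def)

lemma monom_diff_add:
  fixes m n :: "dvar \<Rightarrow>\<^sub>0 nat"
  assumes "Poly_Mapping.lookup m v \<noteq> 0"
  shows "m + n - Poly_Mapping.single v 1 = m - Poly_Mapping.single v 1 + n"
  using assms by (intro poly_mapping_eqI) (auto simp: lookup_add lookup_minus lookup_single when_def)

lemma pd_mult: "pd v (f * g) = pd v f * g + f * pd v g"
proof (induction f rule: poly_mapping_add_induct)
  case (single m c)
  show ?case
  proof (induction g rule: poly_mapping_add_induct)
    case (single n d)
    let ?S = "Poly_Mapping.single"
    \<comment> \<open>Truncated subtraction commutes with adding n only if v occurs in m; otherwise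
      both sides are 0.\<close>
    have 1: "?S (m + n - ?S v 1) (of_nat (Poly_Mapping.lookup m v) * (c * d))
        = ?S (m - ?S v 1 + n) (of_nat (Poly_Mapping.lookup m v) * (c * d))"
      by (cases "Poly_Mapping.lookup m v = 0") (use monom_diff_add in auto)
    have 2: "?S (m + n - ?S v 1) (of_nat (Poly_Mapping.lookup n v) * (c * d))
        = ?S (m + (n - ?S v 1)) (of_nat (Poly_Mapping.lookup n v) * (c * d))"
      by (cases "Poly_Mapping.lookup n v = 0") (use monom_diff_add[of n v m] in \<open>auto simp: add.commute\<close>)
    show ?case
      using 1 2 by (simp add: pd_single mult_single lookup_add algebra_simps single_add)
  qed (simp add: pd_add algebra_simps)
qed (simp add: pd_add algebra_simps)

lemma pd_const [simp]: "pd v (const c) = 0"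
  by (simp add: const_def pd_single)

lemma pd_1 [simp]: "pd v 1 = 0"
  using pd_const[of v 1] by (simp add: const_def)

lemma pd_X: "pd v (X w) = (if v = w then 1 else 0)"
  by (auto simp: X_def pd_single lookup_single)

lemma pd_0 [simp]: "pd v 0 = 0"
  by (simp add: pd_def)

lemma pd_uminus: "pd v (- f) = - pd v f"
proof -
  have "pd v (- f) + pd v f = 0" using pd_add[of v "- f" f] by simp
  then show ?thesis by (simp only: eq_neg_iff_add_eq_0)
qed

lemma pd_diff: "pd v (f - g) = pd v f - pd v g"
  using pd_add[of v f "-g"] by (simp add: pd_uminus)

lemma lookup_pd: "Poly_Mapping.lookup (pd v f) m
    = of_nat (Suc (Poly_Mapping.lookup m v)) * Poly_Mapping.lookup f (m + Poly_Mapping.single v 1)"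
proof (induction f rule: poly_mapping_add_induct)
  case (single n c)
  show ?case
  proof (cases "n = m + Poly_Mapping.single v 1")
    case True
    then have "n - Poly_Mapping.single v 1 = m" "Poly_Mapping.lookup n v = Suc (Poly_Mapping.lookup m v)"
      by (simp_all add: lookup_add)
    then show ?thesis unfolding pd_single using True by simp
  next
    case False
    have "Poly_Mapping.lookup n v = 0" if e: "n - Poly_Mapping.single v 1 = m"
    proof (rule ccontr)
      assume nz: "Poly_Mapping.lookup n v \<noteq> 0"
      have "n = n - Poly_Mapping.single v 1 + Poly_Mapping.single v 1"
        by (intro poly_mapping_eqI) (use nz in \<open>auto simp: lookup_add lookup_minus lookup_single when_def\<close>)
      then show False using e False by simp
    qed
    then have "Poly_Mapping.lookup (pd v (Poly_Mapping.single n c)) m = 0"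
      unfolding pd_single lookup_single when_def by auto
    then show ?thesis using False by (simp add: lookup_single when_def)
  qed
qed (simp_all add: pd_add lookup_add distrib_left)

locale diff_field =
  fixes \<delta> :: "'k::field_char_0 \<Rightarrow> 'k"
  assumes derivation: "is_derivation \<delta>"
begin

lemma delta_add: "\<delta> (a + b) = \<delta> a + \<delta> b" and delta_mult: "\<delta> (a * b) = a * \<delta> b + \<delta> a * b"
  using derivation by (auto simp: is_derivation_def)

lemma delta_0 [simp]: "\<delta> 0 = 0" and delta_1 [simp]: "\<delta> 1 = 0"
  using delta_add[of 0 0] delta_mult[of 1 1] by auto

abbreviation d :: "'k dpoly \<Rightarrow> 'k dpoly" where "d \<equiv> dderiv \<delta>"

lemma d_add: "d (f + g) = d f + d g"
  unfolding dderiv_def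
  by (rule setsum_keys_plus_distrib)
    (simp_all add: delta_add algebra_simps single_add sum.distrib)

text \<open>The index set A may exceed the variables of m, so that two monomials and their product
  can be expanded over one common set in \<open>d_mult\<close>.\<close>

lemma d_single:
  assumes "finite A" "Poly_Mapping.keys m \<subseteq> A"
  shows "d (Poly_Mapping.single m c) = Poly_Mapping.single m (\<delta> c)
      + (\<Sum>v\<in>A. X (dshift v) * pd v (Poly_Mapping.single m c))"
proof -
  have "d (Poly_Mapping.single m c) = Poly_Mapping.single m (\<delta> c)
      + (\<Sum>v\<in>Poly_Mapping.keys m. X (dshift v) * pd v (Poly_Mapping.single m c))"
    by (simp add: dderiv_def X_def pd_single mult_single add.commute)
  also have "(\<Sum>v\<in>Poly_Mapping.keys m. X (dshift v) * pd v (Poly_Mapping.single m c))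
      = (\<Sum>v\<in>A. X (dshift v) * pd v (Poly_Mapping.single m c))"
    by (rule sum.mono_neutral_left) (use assms in \<open>auto simp: pd_single in_keys_iff\<close>)
  finally show ?thesis .
qed

lemma d_mult: "d (f * g) = d f * g + f * d g"
proof (induction f rule: poly_mapping_add_induct)
  case (single m a)
  show ?case
  proof (induction g rule: poly_mapping_add_induct)
    case (single n b)
    let ?S = "Poly_Mapping.single" and ?A = "Poly_Mapping.keys m \<union> Poly_Mapping.keys n"
    have "d (?S m a * ?S n b) = ?S (m + n) (\<delta> (a * b)) + (\<Sum>v\<in>?A. X (dshift v) * pd v (?S m a * ?S n b))"
      unfolding mult_single by (rule d_single) (use Poly_Mapping.keys_add[of m n] in auto)
    also have "\<dots> = ?S m (\<delta> a) * ?S n b + ?S m a * ?S n (\<delta> b) + ((\<Sum>v\<in>?A. X (dshift v) * pd v (?S m a)) * ?S n b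
        + ?S m a * (\<Sum>v\<in>?A. X (dshift v) * pd v (?S n b)))"
    proof -
      have "?S (m + n) (\<delta> (a * b)) = ?S m (\<delta> a) * ?S n b + ?S m a * ?S n (\<delta> b)"
        by (simp add: delta_mult mult_single single_add add.commute)
      moreover have "(\<Sum>v\<in>?A. X (dshift v) * pd v (?S m a * ?S n b))
          = (\<Sum>v\<in>?A. X (dshift v) * pd v (?S m a)) * ?S n b + ?S m a * (\<Sum>v\<in>?A. X (dshift v) * pd v (?S n b))"
        by (simp only: pd_mult sum_distrib_left sum_distrib_right distrib_left sum.distrib ac_simps)
      ultimately show ?thesis by simp
    qed
    also have "\<dots> = d (?S m a) * ?S n b + ?S m a * d (?S n b)"
      by (simp add: d_single[of ?A] algebra_simps)
    finally show ?case .
  qed (simp add: d_add algebra_simps)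
qed (simp add: d_add algebra_simps)

lemma d_const [simp]: "d (const c) = const (\<delta> c)"
  by (simp add: const_def d_single[of "{}"])

lemma d_X: "d (X v) = X (dshift v)"
  by (simp add: X_def dderiv_def mult_single)

lemma d_0 [simp]: "d 0 = 0"
  by (simp add: dderiv_def)

lemma d_1 [simp]: "d 1 = 0"
  using d_const[of 1] by (simp add: const_def)

lemma pd_d_0: "pd (j, 0) (d f) = d (pd (j, 0) f)"
proof -
  have "pd (j, 0) (d f) - d (pd (j, 0) f) = 0"
    by (rule derivation_eqI[where D = "\<lambda>f. pd (j, 0) (d f) - d (pd (j, 0) f)" and E = "\<lambda>f. 0"])
      (simp_all add: d_add d_mult d_X pd_add pd_mult pd_X algebra_simps dshift_def)
  then show ?thesis by simp
qed

text \<open>The commutator of two derivations is a derivation, so it is determined on generators: it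
  kills constants, sends the variable (j, r) to 1 and all other variables to 0.\<close>

lemma pd_d_Suc: "pd (j, Suc r) (d f) = d (pd (j, Suc r) f) + pd (j, r) f"
proof -
  have "pd (j, Suc r) (d f) - d (pd (j, Suc r) f) = pd (j, r) f"
    by (rule derivation_eqI[where D = "\<lambda>f. pd (j, Suc r) (d f) - d (pd (j, Suc r) f)"
          and E = "pd (j, r)"])
      (auto simp add: d_add d_mult d_X pd_add pd_mult pd_X algebra_simps dshift_def prod_eq_iff)
  then show ?thesis by (simp add: algebra_simps)
qed

end

section \<open>Degrees and variables\<close>

lemma deg_in_le_iff: "deg_in u f \<le> n \<longleftrightarrow> (\<forall>m\<in>Poly_Mapping.keys f. Poly_Mapping.lookup m u \<le> n)"
  by (simp add: deg_in_def)

lemma deg_in_less_iff: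
  "0 < n \<Longrightarrow> deg_in u f < n \<longleftrightarrow> (\<forall>m\<in>Poly_Mapping.keys f. Poly_Mapping.lookup m u < n)"
  by (simp add: deg_in_def)

lemma deg_in_0_iff: "deg_in u f = 0 \<longleftrightarrow> u \<notin> dvars f"
  using deg_in_le_iff[of u f 0] by (auto simp: dvars_def in_keys_iff)

lemma deg_in_pos_iff: "0 < deg_in u f \<longleftrightarrow> u \<in> dvars f"
  using deg_in_0_iff[of u f] by auto

lemma finite_dvars [simp]: "finite (dvars f)"
  by (simp add: dvars_def)

lemma deg_in_0 [simp]: "deg_in u 0 = 0"
  by (simp add: deg_in_def)

lemma deg_in_add: "deg_in u (f + g) \<le> max (deg_in u f) (deg_in u g)"
  unfolding deg_in_le_iff
proof
  fix m assume "m \<in> Poly_Mapping.keys (f + g)"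
  then have "m \<in> Poly_Mapping.keys f \<or> m \<in> Poly_Mapping.keys g"
    using Poly_Mapping.keys_add[of f g] by auto
  then show "Poly_Mapping.lookup m u \<le> max (deg_in u f) (deg_in u g)"
    using deg_in_le_iff[of u f "deg_in u f"] deg_in_le_iff[of u g "deg_in u g"]
    by (auto simp: le_max_iff_disj)
qed

lemma keys_uminus: "Poly_Mapping.keys (- f) = Poly_Mapping.keys (f :: 'k::field_char_0 dpoly)"
  by (auto simp: in_keys_iff)

lemma deg_in_uminus: "deg_in u (- f) = deg_in u (f :: 'k::field_char_0 dpoly)"
  by (simp add: deg_in_def keys_uminus)

lemma deg_in_diff: "deg_in u (f - g) \<le> max (deg_in u f) (deg_in u (g :: 'k::field_char_0 dpoly))"
  using deg_in_add[of u f "- g"] by (simp add: deg_in_uminus)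

lemma deg_in_mult: "deg_in u (f * g) \<le> deg_in u f + deg_in u (g :: 'k::field_char_0 dpoly)"
  unfolding deg_in_le_iff
proof
  fix m assume "m \<in> Poly_Mapping.keys (f * g)"
  then obtain a b where "m = a + b" "a \<in> Poly_Mapping.keys f" "b \<in> Poly_Mapping.keys g"
    using Poly_Mapping.keys_mult[of f g] by blast
  then show "Poly_Mapping.lookup m u \<le> deg_in u f + deg_in u g"
    using deg_in_le_iff[of u f "deg_in u f"] deg_in_le_iff[of u g "deg_in u g"]
    by (auto simp: lookup_add add_mono)
qed

lemma X_power: "(X v :: 'k::field_char_0 dpoly) ^ n = Poly_Mapping.single (Poly_Mapping.single v n) 1"
proof (induction n)
  case (Suc n)
  have "(X v :: 'k dpoly) ^ Suc n = X v * Poly_Mapping.single (Poly_Mapping.single v n) 1" using Suc by simp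
  also have "\<dots> = Poly_Mapping.single (Poly_Mapping.single v (Suc n)) 1"
    unfolding X_def mult_single single_add[symmetric] by simp
  finally show ?case .
qed simp

lemma deg_in_X_power: "deg_in u (X v ^ n) = (if u = v then n else 0)"
  by (simp add: X_power deg_in_def lookup_single when_def)

lemma dvars_X_power: "dvars (X v ^ n) \<subseteq> {v}"
  by (simp add: X_power dvars_def)

lemma dvars_const [simp]: "dvars (const c) = {}"
  by (simp add: dvars_def const_def)

lemma dvars_0 [simp]: "dvars 0 = {}"
  by (simp add: dvars_def)

lemma dvars_empty_imp_const:
  assumes "dvars (f :: 'k::field_char_0 dpoly) = {}"
  obtains c where "f = const c"
proof
  have "m = 0" if "m \<in> Poly_Mapping.keys f" for m
    using assms that by (auto simp: dvars_def)
  then show "f = const (Poly_Mapping.lookup f 0)"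
    by (intro poly_mapping_eqI) (auto simp: const_def lookup_single when_def in_keys_iff)
qed

lemma dvars_add: "dvars (f + g) \<subseteq> dvars f \<union> dvars g"
  using Poly_Mapping.keys_add[of f g] by (auto simp: dvars_def)

lemma dvars_uminus: "dvars (- f) = dvars (f :: 'k::field_char_0 dpoly)"
  by (simp add: dvars_def keys_uminus)

lemma dvars_mult: "dvars (f * g) \<subseteq> dvars f \<union> dvars (g :: 'k::field_char_0 dpoly)"
proof
  fix u assume "u \<in> dvars (f * g)"
  then have "0 < deg_in u (f * g)" by (simp add: deg_in_pos_iff)
  then have "0 < deg_in u f \<or> 0 < deg_in u g" using deg_in_mult[of u f g] by linarith
  then show "u \<in> dvars f \<union> dvars g" by (simp add: deg_in_pos_iff)
qed

text \<open>Characteristic zero: a monomial containing v survives in \<open>pd v f\<close>, because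
  its coefficient is multiplied by a positive integer.\<close>

lemma in_dvars_iff_pd: "v \<in> dvars f \<longleftrightarrow> pd v f \<noteq> 0"
proof
  assume "v \<in> dvars f"
  then obtain m where m: "m \<in> Poly_Mapping.keys f" "v \<in> Poly_Mapping.keys m"
    by (auto simp: dvars_def)
  have "m = m - Poly_Mapping.single v 1 + Poly_Mapping.single v 1"
    using m(2) by (intro poly_mapping_eqI)
      (auto simp: lookup_add lookup_minus lookup_single when_def in_keys_iff)
  then have "Poly_Mapping.lookup (pd v f) (m - Poly_Mapping.single v 1) \<noteq> 0"
    using m(1) unfolding lookup_pd by (simp add: in_keys_iff del: of_nat_Suc)
  then show "pd v f \<noteq> 0" by auto
next
  assume "pd v f \<noteq> 0"
  then obtain m where "Poly_Mapping.lookup (pd v f) m \<noteq> 0"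
    by (metis poly_mapping_eqI lookup_zero)
  then have "m + Poly_Mapping.single v 1 \<in> Poly_Mapping.keys f"
    by (auto simp: lookup_pd in_keys_iff)
  then show "v \<in> dvars f"
    by (force simp: dvars_def in_keys_iff lookup_add)
qed

lemma keys_pd:
  assumes "m \<in> Poly_Mapping.keys (pd v f)"
  shows "m + Poly_Mapping.single v 1 \<in> Poly_Mapping.keys f"
  using assms by (auto simp: in_keys_iff lookup_pd)

lemma deg_in_pd: "deg_in w (pd v f) \<le> deg_in w f"
  unfolding deg_in_le_iff
proof
  fix m assume "m \<in> Poly_Mapping.keys (pd v f)"
  then have "Poly_Mapping.lookup (m + Poly_Mapping.single v 1) w \<le> deg_in w f"
    using keys_pd deg_in_le_iff by blast
  then show "Poly_Mapping.lookup m w \<le> deg_in w f" by (simp add: lookup_add)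
qed

lemma deg_in_pd_less: "v \<in> dvars f \<Longrightarrow> deg_in v (pd v f) < deg_in v f"
proof -
  assume "v \<in> dvars f"
  then have pos: "0 < deg_in v f" by (simp add: deg_in_pos_iff)
  have "Poly_Mapping.lookup m v < deg_in v f" if "m \<in> Poly_Mapping.keys (pd v f)" for m
  proof -
    have "Poly_Mapping.lookup (m + Poly_Mapping.single v 1) v \<le> deg_in v f"
      using that keys_pd deg_in_le_iff by blast
    then show ?thesis by (simp add: lookup_add)
  qed
  then show ?thesis using deg_in_less_iff[OF pos] by blast
qed

lemma dvars_pd: "dvars (pd v f) \<subseteq> dvars f"
  using deg_in_pd[of _ v f] deg_in_pos_iff by (metis less_le_trans subsetI)

lemma sum_monomials: "(\<Sum>m\<in>Poly_Mapping.keys f. Poly_Mapping.single m (Poly_Mapping.lookup f m)) = f"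
proof (rule poly_mapping_eqI)
  fix k
  have "(\<Sum>m\<in>Poly_Mapping.keys f. if m = k then Poly_Mapping.lookup f m else 0) = Poly_Mapping.lookup f k"
    by (auto simp: sum.delta' in_keys_iff)
  then show "Poly_Mapping.lookup (\<Sum>m\<in>Poly_Mapping.keys f. Poly_Mapping.single m (Poly_Mapping.lookup f m)) k
      = Poly_Mapping.lookup f k"
    by (simp add: lookup_sum lookup_single when_def)
qed

text \<open>Both pieces obey the degree bounds of f in every variable, so that they inherit
  reducedness. The condition on f0 is put on monomials because it then also makes sense when
  \<open>deg_in v f\<close> is 0, where it forces f0 to vanish.\<close>

lemma leading_coeff_decomp:
  fixes f :: "'k::field_char_0 dpoly"
  obtains c f0 where "f = c * X v ^ deg_in v f + f0" "deg_in v c = 0"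
    "\<And>m. m \<in> Poly_Mapping.keys f0 \<Longrightarrow> Poly_Mapping.lookup m v < deg_in v f"
    "\<And>w. deg_in w c \<le> deg_in w f" "\<And>w. deg_in w f0 \<le> deg_in w f"
proof -
  let ?n = "deg_in v f" and ?S = "Poly_Mapping.single" and ?l = "Poly_Mapping.lookup"
  define A where "A = {m \<in> Poly_Mapping.keys f. ?l m v = ?n}"
  define B where "B = {m \<in> Poly_Mapping.keys f. ?l m v \<noteq> ?n}"
  define c where "c = (\<Sum>m\<in>A. ?S (m - ?S v ?n) (?l f m))"
  define f0 where "f0 = (\<Sum>m\<in>B. ?S m (?l f m))"
  have fin: "finite A" "finite B" by (auto simp: A_def B_def)
  have "c * X v ^ ?n = (\<Sum>m\<in>A. ?S m (?l f m))"
  proof -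
    have "?S (m - ?S v ?n) (?l f m) * X v ^ ?n = ?S m (?l f m)" if "m \<in> A" for m
    proof -
      have "m - ?S v ?n + ?S v ?n = m"
        using that by (intro poly_mapping_eqI) (auto simp: A_def lookup_add lookup_minus lookup_single when_def)
      then show ?thesis by (simp add: X_power mult_single)
    qed
    then show ?thesis by (simp add: c_def sum_distrib_right)
  qed
  moreover have "f = (\<Sum>m\<in>A. ?S m (?l f m)) + f0"
    using sum.union_disjoint[OF fin, of "\<lambda>m. ?S m (?l f m)"] sum_monomials[of f]
    by (simp add: f0_def A_def B_def Int_def Un_def conj_disj_distribL[symmetric] cong: conj_cong)
  ultimately have 1: "f = c * X v ^ ?n + f0" by simp
  have kc: "\<exists>m'\<in>A. m = m' - ?S v ?n" if "m \<in> Poly_Mapping.keys c" for m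
    using that Poly_Mapping.keys_sum[of "\<lambda>m. ?S (m - ?S v ?n) (?l f m)" A]
    by (auto simp: c_def split: if_splits)
  have kf: "m \<in> B" if "m \<in> Poly_Mapping.keys f0" for m
    using that Poly_Mapping.keys_sum[of "\<lambda>m. ?S m (?l f m)" B] by (auto simp: f0_def split: if_splits)
  have "deg_in v c \<le> 0" unfolding deg_in_le_iff
    using kc by (fastforce simp: A_def lookup_minus)
  moreover have "?l m v < ?n" if "m \<in> Poly_Mapping.keys f0" for m
    using kf[OF that] deg_in_le_iff[of v f ?n] by (auto simp: B_def order.strict_iff_order)
  moreover have "deg_in w c \<le> deg_in w f" for w unfolding deg_in_le_iff
  proof
    fix m assume "m \<in> Poly_Mapping.keys c"
    then obtain m' where "m' \<in> A" "m = m' - ?S v ?n" using kc by blast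
    moreover have "?l m' w \<le> deg_in w f" using \<open>m' \<in> A\<close> deg_in_le_iff A_def by blast
    ultimately show "?l m w \<le> deg_in w f" by (simp add: lookup_minus)
  qed
  moreover have "deg_in w f0 \<le> deg_in w f" for w unfolding deg_in_le_iff
    using kf deg_in_le_iff[of w f "deg_in w f"] by (auto simp: B_def)
  ultimately show ?thesis using that 1 by blast
qed

section \<open>The ring of differential polynomials in finitely many indeterminates\<close>

lemma dring_dvars: "f \<in> dring l \<longleftrightarrow> dvars f \<subseteq> dvars_of l"
  by (auto simp: dring_def dvars_of_def)

lemma dring_const [simp]: "const c \<in> dring l" and dring_0 [simp]: "0 \<in> dring l"
  by (simp_all add: dring_dvars)

lemma dring_1 [simp]: "1 \<in> dring l"
  by (simp add: dring_dvars dvars_def)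

lemma dring_add [intro]: "f \<in> dring l \<Longrightarrow> g \<in> dring l \<Longrightarrow> f + g \<in> dring l"
  using dvars_add[of f g] by (auto simp: dring_dvars)

lemma dring_uminus [intro]: "f \<in> dring l \<Longrightarrow> - f \<in> dring l" for f :: "'k::field_char_0 dpoly"
  by (simp add: dring_dvars dvars_uminus)

lemma dring_mult [intro]: "f \<in> dring l \<Longrightarrow> g \<in> dring l \<Longrightarrow> f * g \<in> dring l" for f :: "'k::field_char_0 dpoly"
  using dvars_mult[of f g] by (auto simp: dring_dvars)

lemma dring_pd [intro]: "f \<in> dring l \<Longrightarrow> pd v f \<in> dring l"
  using dvars_pd[of v f] by (auto simp: dring_dvars)

lemma dring_X_power [intro]: "v \<in> dvars_of l \<Longrightarrow> X v ^ n \<in> dring l"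
  using dvars_X_power[of v n] by (auto simp: dring_dvars)

lemma (in diff_field) dvars_d:
  assumes "v \<in> dvars (d f)"
  shows "v \<in> dvars f \<or> (\<exists>w\<in>dvars f. v = dshift w)"
proof (cases v)
  case (Pair j r)
  then show ?thesis using assms
    by (cases r) (force simp: in_dvars_iff_pd pd_d_0 pd_d_Suc dshift_def)+
qed

lemma (in diff_field) dring_d [intro]: "f \<in> dring l \<Longrightarrow> d f \<in> dring l"
  using dvars_d[of _ f] by (fastforce simp: dring_def dshift_def)

section \<open>Abstract dependence relations\<close>

text \<open>A closure operator with Steinitz exchange, kept abstract to separate the cardinality
  bound from the algebra that supplies the relation.\<close>

locale dependence_relation =
  fixes dep :: "'a \<Rightarrow> 'a set \<Rightarrow> bool"
  assumes dep_mem: "v \<in> S \<Longrightarrow> dep v S"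
    and dep_trans: "dep v S \<Longrightarrow> (\<And>s. s \<in> S \<Longrightarrow> dep s T) \<Longrightarrow> dep v T"
    and dep_exchange: "dep v (insert w S) \<Longrightarrow> \<not> dep v S \<Longrightarrow> dep w (insert v S)"
begin

lemma dep_mono: "dep v S \<Longrightarrow> S \<subseteq> T \<Longrightarrow> dep v T"
  by (meson dep_trans dep_mem subsetD)

definition indep :: "'a set \<Rightarrow> bool" where
  "indep I \<longleftrightarrow> (\<forall>v\<in>I. \<not> dep v (I - {v}))"

lemma indep_subset: "indep I \<Longrightarrow> J \<subseteq> I \<Longrightarrow> indep J"
  unfolding indep_def by (meson Diff_mono dep_mono subset_refl subsetD)

text \<open>An element w of T outside I is traded for an element v of I outside T. This keeps
  \<open>card T\<close> and the spanning property, and brings T closer to containing I.\<close>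

lemma indep_card_le:
  assumes "indep I" "finite I" "finite T" "\<And>v. v \<in> I \<Longrightarrow> dep v T"
  shows "card I \<le> card T"
  using assms(3,4)
proof (induction "card (I - T)" arbitrary: T rule: less_induct)
  case less
  show ?case
  proof (cases "I \<subseteq> T")
    case True
    then show ?thesis using less.prems by (simp add: card_mono)
  next
    case False
    then obtain v where v: "v \<in> I" "v \<notin> T" by blast
    \<comment> \<open>A minimal set that spans v and contains T \<inter> I. By independence it has a
      member w outside I, and minimality makes w indispensable, which is what exchange asks
      for.\<close>
    define \<S> where "\<S> = {T0. T \<inter> I \<subseteq> T0 \<and> T0 \<subseteq> T \<and> dep v T0}"
    have "finite \<S>" using less.prems(1) by (intro finite_subset[of \<S> "Pow T"]) (auto simp: \<S>_def)
    moreover have "T \<in> \<S>" using less.prems(2) v by (auto simp: \<S>_def)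
    ultimately obtain T0 where T0: "T0 \<in> \<S>" "\<And>T1. T1 \<in> \<S> \<Longrightarrow> T1 \<subseteq> T0 \<Longrightarrow> T1 = T0"
      using finite_has_minimal[of \<S>] by blast
    have "\<not> dep v (T \<inter> I)"
    proof
      assume "dep v (T \<inter> I)"
      then have "dep v (I - {v})" by (rule dep_mono) (use v in auto)
      then show False using assms(1) v by (auto simp: indep_def)
    qed
    then have "\<not> T0 \<subseteq> T \<inter> I" using T0(1) dep_mono by (auto simp: \<S>_def)
    then obtain w where w: "w \<in> T0" "w \<notin> I" using T0(1) by (auto simp: \<S>_def)
    have "\<not> dep v (T0 - {w})"
      using T0(2)[of "T0 - {w}"] T0(1) w by (auto simp: \<S>_def)
    moreover have "dep v (insert w (T0 - {w}))" using T0 w by (auto simp: \<S>_def insert_absorb)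
    ultimately have dw: "dep w (insert v (T0 - {w}))" by (rule dep_exchange[rotated])
    define T' where "T' = insert v (T - {w})"
    have wT: "w \<in> T" using T0 w by (auto simp: \<S>_def)
    have "dep w T'" using dw by (rule dep_mono) (use T0 in \<open>auto simp: T'_def \<S>_def\<close>)
    then have "dep x T'" if "x \<in> T" for x
      using that by (cases "x = w") (auto simp: T'_def intro: dep_mem)
    then have "dep x T'" if "x \<in> I" for x
      using less.prems(2)[OF that] by (rule dep_trans[rotated])
    moreover have "card (I - T') < card (I - T)"
      using v w assms(2) by (intro psubset_card_mono) (auto simp: T'_def)
    ultimately have "card I \<le> card T'"
      using less.hyps less.prems(1) by (simp add: T'_def)
    also have "card T' = card T"
      using v less.prems(1) card_Suc_Diff1[OF less.prems(1) wT] by (simp add: T'_def)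
    finally show ?thesis .
  qed
qed

end

section \<open>Rankings and characteristic sets\<close>

lemma dshift_in_dvars_of [simp]: "dshift v \<in> dvars_of l \<longleftrightarrow> v \<in> dvars_of l"
  by (simp add: dvars_of_def dshift_def)

locale ranked =
  fixes l :: nat and rk :: "dvar \<Rightarrow> dvar \<Rightarrow> bool"
  assumes ranking: "ranking l rk"
begin

abbreviation V :: "dvar set" where "V \<equiv> dvars_of l"

definition lt :: "dvar \<Rightarrow> dvar \<Rightarrow> bool" where "lt u v \<longleftrightarrow> rk u v \<and> u \<noteq> v"

lemma rk_refl: "u \<in> V \<Longrightarrow> rk u u"
  and rk_antisym: "u \<in> V \<Longrightarrow> v \<in> V \<Longrightarrow> rk u v \<Longrightarrow> rk v u \<Longrightarrow> u = v"
  and rk_trans: "u \<in> V \<Longrightarrow> v \<in> V \<Longrightarrow> w \<in> V \<Longrightarrow> rk u v \<Longrightarrow> rk v w \<Longrightarrow> rk u w"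
  and rk_total: "u \<in> V \<Longrightarrow> v \<in> V \<Longrightarrow> rk u v \<or> rk v u"
  and rk_dshift: "u \<in> V \<Longrightarrow> rk u (dshift u)"
  and rk_dshift_mono: "u \<in> V \<Longrightarrow> v \<in> V \<Longrightarrow> rk u v \<Longrightarrow> rk (dshift u) (dshift v)"
  using ranking unfolding ranking_def by blast+

lemma rk_iff_not_lt: "u \<in> V \<Longrightarrow> v \<in> V \<Longrightarrow> rk u v \<longleftrightarrow> \<not> lt v u"
  using rk_total[of u v] rk_antisym[of u v] rk_refl[of u] unfolding lt_def by blast

lemma lt_dshift: "u \<in> V \<Longrightarrow> lt u (dshift u)"
  using rk_dshift[of u] by (auto simp: lt_def dshift_def prod_eq_iff)

lemma rk_same: "j < l \<Longrightarrow> r \<le> s \<Longrightarrow> rk (j, r) (j, s)"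
proof (induction s)
  case 0
  then show ?case using rk_refl by (simp add: dvars_of_def)
next
  case (Suc s)
  then show ?case
    using rk_dshift[of "(j, s)"] rk_trans[of "(j, r)" "(j, s)" "(j, Suc s)"] rk_refl
    by (cases "r = Suc s") (auto simp: dvars_of_def dshift_def)
qed

lemma lt_same_iff: "j < l \<Longrightarrow> lt (j, r) (j, s) \<longleftrightarrow> r < s"
  using rk_same[of j r s] rk_same[of j s r] rk_antisym[of "(j, r)" "(j, s)"]
  by (cases r s rule: linorder_cases) (auto simp: lt_def dvars_of_def)

lemma finite_has_max:
  assumes "finite A" "A \<noteq> {}" "A \<subseteq> V"
  obtains u where "u \<in> A" "\<And>w. w \<in> A \<Longrightarrow> rk w u"
proof -
  have "\<exists>u\<in>A. \<forall>w\<in>A. rk w u"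
    using assms
  proof (induction rule: finite_ne_induct)
    case (singleton x)
    then show ?case using rk_refl by auto
  next
    case (insert x F)
    then obtain u where u: "u \<in> F" "\<forall>w\<in>F. rk w u" by auto
    then have V: "x \<in> V" "u \<in> V" "F \<subseteq> V" using insert by auto
    show ?case
    proof (cases "rk x u")
      case True
      then show ?thesis using u by auto
    next
      case False
      then have "rk u x" using rk_total V by blast
      then have "\<forall>w\<in>insert x F. rk w x" using u V rk_trans rk_refl by blast
      then show ?thesis by blast
    qed
  qed
  then show ?thesis using that by blast
qed

lemma finite_has_min:
  assumes "finite A" "A \<noteq> {}" "A \<subseteq> V"
  obtains u where "u \<in> A" "\<And>w. w \<in> A \<Longrightarrow> rk u w"
proof -
  have "\<exists>u\<in>A. \<forall>w\<in>A. rk u w"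
    using assms
  proof (induction rule: finite_ne_induct)
    case (singleton x)
    then show ?case using rk_refl by auto
  next
    case (insert x F)
    then obtain u where u: "u \<in> F" "\<forall>w\<in>F. rk u w" by auto
    then have V: "x \<in> V" "u \<in> V" "F \<subseteq> V" using insert by auto
    show ?case
    proof (cases "rk u x")
      case True
      then show ?thesis using u by auto
    next
      case False
      then have "rk x u" using rk_total V by blast
      then have "\<forall>w\<in>insert x F. rk x w" using u V rk_trans rk_refl by blast
      then show ?thesis by blast
    qed
  qed
  then show ?thesis using that by blast
qed

section \<open>Well-foundedness of a ranking\<close>

definition Lt :: "(dvar \<times> dvar) set" where
  "Lt = {(u, v). u \<in> V \<and> v \<in> V \<and> lt u v}"

lemma wf_Lt: "wf Lt"
proof (rule wfI_min)
  fix x :: dvar and Q assume "x \<in> Q"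
  show "\<exists>z\<in>Q. \<forall>y. (y, z) \<in> Lt \<longrightarrow> y \<notin> Q"
  proof (cases "Q \<inter> V = {}")
    case True
    then show ?thesis using \<open>x \<in> Q\<close> by (auto simp: Lt_def)
  next
    case False
    \<comment> \<open>Within a column the ranking follows the order, so the lowest element of Q
      there can represent the column; the least of these at most l representatives is minimal in
      Q.\<close>
    define least where "least j = (LEAST r. (j, r) \<in> Q)" for j
    define M where "M = (\<lambda>j. (j, least j)) ` {j. j < l \<and> (\<exists>r. (j, r) \<in> Q)}"
    have M: "M \<subseteq> Q \<inter> V" by (auto simp: M_def least_def dvars_of_def intro: LeastI)
    moreover have "finite M" "M \<noteq> {}" using False by (auto simp: M_def dvars_of_def)
    ultimately obtain z where z: "z \<in> M" "\<And>w. w \<in> M \<Longrightarrow> rk z w"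
      using finite_has_min[of M] by auto
    have "\<not> lt y z" if y: "y \<in> Q" "y \<in> V" for y
    proof -
      obtain j r where [simp]: "y = (j, r)" by (cases y)
      have j: "j < l" using y by (simp add: dvars_of_def)
      then have "(j, least j) \<in> M" using y by (auto simp: M_def)
      moreover have "rk (j, least j) y"
        using rk_same[OF j, of "least j" r] y by (simp add: least_def Least_le)
      ultimately have "rk z y" using z M y rk_trans[of z "(j, least j)" y] by auto
      then show ?thesis using rk_iff_not_lt[of z y] z M y by blast
    qed
    then show ?thesis using z M unfolding Lt_def by blast
  qed
qed

section \<open>Leaders, autoreduced sets and existence of characteristic sets\<close>

lemma leader_eqI:
  assumes "u \<in> dvars f" "\<And>w. w \<in> dvars f \<Longrightarrow> rk w u" "f \<in> dring l"
  shows "leader rk f = u"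
  unfolding leader_def
proof (rule the_equality)
  fix u' assume "u' \<in> dvars f \<and> (\<forall>w\<in>dvars f. rk w u')"
  then show "u' = u" using assms rk_antisym[of u' u] by (auto simp: dring_dvars)
qed (use assms in auto)

lemma
  assumes "f \<in> dring l" "\<not> is_const f"
  shows leader_in: "leader rk f \<in> dvars f"
    and leader_max: "w \<in> dvars f \<Longrightarrow> rk w (leader rk f)"
    and leader_V: "leader rk f \<in> V"
proof -
  obtain u where u: "u \<in> dvars f" "\<And>w. w \<in> dvars f \<Longrightarrow> rk w u"
    using finite_has_max[of "dvars f"] assms by (auto simp: is_const_def dring_dvars)
  then have "leader rk f = u" using leader_eqI assms by blast
  then show "leader rk f \<in> dvars f" "w \<in> dvars f \<Longrightarrow> rk w (leader rk f)" "leader rk f \<in> V"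
    using u assms by (auto simp: dring_dvars)
qed

lemma autoreduced_nth:
  assumes "autoreduced l rk A" "a < length A"
  shows "A ! a \<in> dring l" "\<not> is_const (A ! a)" "leader rk (A ! a) \<in> V"
proof -
  show "A ! a \<in> dring l" "\<not> is_const (A ! a)"
    using assms nth_mem[of a A] by (auto simp: autoreduced_def)
  then show "leader rk (A ! a) \<in> V" by (rule leader_V)
qed

text \<open>With a single derivation, leaders in one indeterminate are derivatives of each other.
  The higher one occurs in its own polynomial, against reducedness; equal leaders would need each
  degree to be below the other.\<close>

lemma autoreduced_fst_leader:
  assumes "autoreduced l rk A" "a < length A" "b < length A" "a \<noteq> b"
  shows "fst (leader rk (A ! a)) \<noteq> fst (leader rk (A ! b))"
proof
  assume eq: "fst (leader rk (A ! a)) = fst (leader rk (A ! b))"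
  have ab: "reduced rk (A ! a) (A ! b)" "reduced rk (A ! b) (A ! a)"
    using assms by (auto simp: autoreduced_def)
  have "A ! a \<in> dring l" "A ! b \<in> dring l" "\<not> is_const (A ! a)" "\<not> is_const (A ! b)"
    using assms by (auto simp: autoreduced_def)
  then have la: "leader rk (A ! a) \<in> dvars (A ! a)" "leader rk (A ! b) \<in> dvars (A ! b)"
    using leader_in by auto
  consider "snd (leader rk (A ! a)) < snd (leader rk (A ! b))"
    | "snd (leader rk (A ! b)) < snd (leader rk (A ! a))"
    | "snd (leader rk (A ! a)) = snd (leader rk (A ! b))" by linarith
  then show False
  proof cases
    case 1
    then have "leader rk (A ! b) = (fst (leader rk (A ! a)), snd (leader rk (A ! a)) + (snd (leader rk (A ! b)) - snd (leader rk (A ! a))))"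
      using eq by (simp add: prod_eq_iff)
    then show False using ab(2) la(2) 1 unfolding reduced_def by (metis zero_less_diff)
  next
    case 2
    then have "leader rk (A ! a) = (fst (leader rk (A ! b)), snd (leader rk (A ! b)) + (snd (leader rk (A ! a)) - snd (leader rk (A ! b))))"
      using eq by (simp add: prod_eq_iff)
    then show False using ab(1) la(1) 2 unfolding reduced_def by (metis zero_less_diff)
  next
    case 3
    then have "leader rk (A ! a) = leader rk (A ! b)" using eq by (simp add: prod_eq_iff)
    then show False using ab by (auto simp: reduced_def)
  qed
qed

lemma autoreduced_length:
  assumes "autoreduced l rk A"
  shows "length A \<le> l"
proof -
  have "inj_on (\<lambda>a. fst (leader rk (A ! a))) {..<length A}"
    using autoreduced_fst_leader[OF assms] by (auto simp: inj_on_def)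
  moreover have "(\<lambda>a. fst (leader rk (A ! a))) ` {..<length A} \<subseteq> {..<l}"
    using autoreduced_nth(3)[OF assms] by (auto simp: dvars_of_def)
  ultimately have "card {..<length A} \<le> card {..<l}"
    by (meson card_inj_on_le finite_lessThan)
  then show ?thesis by simp
qed

definition lead_rank :: "'k::zero dpoly \<Rightarrow> dvar \<times> nat" where
  "lead_rank f = (leader rk f, deg_in (leader rk f) f)"

text \<open>Padding with entries above all ranks turns the comparison of autoreduced sets, in which a
  proper extension is lower, into the lexicographic order on lists of length l.\<close>

definition padded_ranks :: "'k::zero dpoly list \<Rightarrow> (nat \<times> dvar \<times> nat) list" where
  "padded_ranks A = map (\<lambda>i. if i < length A then (0, lead_rank (A ! i)) else (1, undefined)) [0..<l]"

definition Rank_lt :: "((nat \<times> dvar \<times> nat) \<times> (nat \<times> dvar \<times> nat)) set" where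
  "Rank_lt = less_than <*lex*> (Lt <*lex*> less_than)"

lemma lexnI:
  assumes "length xs = n" "length ys = n" "i < n" "\<And>j. j < i \<Longrightarrow> xs ! j = ys ! j" "(xs ! i, ys ! i) \<in> r"
  shows "(xs, ys) \<in> lexn r n"
proof -
  have "take i xs = take i ys" using assms by (intro nth_equalityI) auto
  then have "xs = take i xs @ xs ! i # drop (Suc i) xs" "ys = take i xs @ ys ! i # drop (Suc i) ys"
    using assms id_take_nth_drop[of i xs] id_take_nth_drop[of i ys] by auto
  then show ?thesis using assms unfolding lexn_conv by blast
qed

lemma aset_less_imp_lexn:
  assumes A: "autoreduced l rk A" and B: "autoreduced l rk B" and "aset_less rk A B"
  shows "(padded_ranks A, padded_ranks B) \<in> lexn Rank_lt l"
proof -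
  have len: "length A \<le> l" "length B \<le> l" using autoreduced_length A B by auto
  have AV: "leader rk (A ! i) \<in> V" if "i < length A" for i using autoreduced_nth A that by blast
  have BV: "leader rk (B ! i) \<in> V" if "i < length B" for i using autoreduced_nth B that by blast
  from assms(3) consider i where "i < length A" "i < length B" "\<forall>j<i. same_rank rk (A ! j) (B ! j)"
      "poly_less rk (A ! i) (B ! i)"
    | "length B < length A" "\<forall>j<length B. same_rank rk (A ! j) (B ! j)"
    unfolding aset_less_def by auto
  then show ?thesis
  proof cases
    case 1
    show ?thesis
    proof (rule lexnI[of _ _ _ i])
      show "(padded_ranks A ! i, padded_ranks B ! i) \<in> Rank_lt"
        using 1 len AV BV
        by (auto simp: padded_ranks_def Rank_lt_def Lt_def poly_less_def lt_def lead_rank_def)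
    qed (use 1 len in \<open>auto simp: padded_ranks_def same_rank_def lead_rank_def\<close>)
  next
    case 2
    \<comment> \<open>At position \<open>length B\<close> the list A still has a genuine entry,
      tagged 0, while B has its first padding entry, tagged 1.\<close>
    show ?thesis
      by (rule lexnI[of _ _ _ "length B"])
        (use 2 len in \<open>auto simp: padded_ranks_def Rank_lt_def same_rank_def lead_rank_def\<close>)
  qed
qed

lemma char_set_exists: "\<exists>C :: 'a::zero dpoly list. char_set l rk P C"
proof -
  have wf: "wf (inv_image (lexn Rank_lt l) padded_ranks)"
    unfolding Rank_lt_def by (intro wf_inv_image wf_lexn wf_lex_prod wf_Lt wf_less_than)
  define Q :: "'a::zero dpoly list set" where "Q = {A. autoreduced l rk A \<and> set A \<subseteq> P}"
  have "[] \<in> Q" by (simp add: Q_def autoreduced_def)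
  then obtain C where C: "C \<in> Q" "\<And>B. (B, C) \<in> inv_image (lexn Rank_lt l) padded_ranks \<Longrightarrow> B \<notin> Q"
    by (rule wfE_min[OF wf]) blast
  have "\<not> aset_less rk B C" if "B \<in> Q" for B
    using C(2)[of B] that aset_less_imp_lexn[of B C] C(1) by (auto simp: Q_def)
  then show ?thesis
    using C(1) unfolding char_set_def Q_def by blast
qed

text \<open>Putting g behind the members of lower rank and dropping the rest would give an
  autoreduced subset of P lower than C.\<close>

lemma char_set_no_reduced:
  fixes C :: "'k::field_char_0 dpoly list"
  assumes C: "char_set l rk P C" and g: "g \<in> P" "g \<in> dring l" "\<not> is_const g"
    and red: "\<And>f. f \<in> set C \<Longrightarrow> reduced rk g f"
  shows False
proof -
  define n where "n = length (takeWhile (\<lambda>f. poly_less rk f g) C)"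
  define B where "B = take n C @ [g]"
  have ar: "autoreduced l rk C" and CP: "set C \<subseteq> P" using C by (auto simp: char_set_def)
  have nC: "n \<le> length C" by (simp add: n_def length_takeWhile_le)
  have low: "poly_less rk (C ! i) g" if "i < n" for i
    using that nth_mem[of i "takeWhile (\<lambda>f. poly_less rk f g) C"]
      takeWhile_nth[of i "\<lambda>f. poly_less rk f g" C]
    by (auto simp: n_def dest!: set_takeWhileD)
  have nth_lt: "B ! i = C ! i" if "i < n" for i using that nC by (simp add: B_def nth_append)
  have nth_n: "B ! n = g" using nC by (simp add: B_def nth_append)
  have len: "length B = Suc n" using nC by (simp add: B_def)
  have redg: "reduced rk (C ! i) g" if i: "i < n" for i
  proof -
    have Ci: "C ! i \<in> dring l" "\<not> is_const (C ! i)" using autoreduced_nth[OF ar] i nC by auto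
    have rl: "rk (leader rk (C ! i)) (leader rk g)"
      using low[OF i] rk_refl[OF leader_V[OF g(2,3)]] by (auto simp: poly_less_def)
    have lV: "leader rk (C ! i) \<in> V" "leader rk g \<in> V"
      using leader_V Ci g by blast+
    have "v \<notin> dvars (C ! i)" if v: "lt (leader rk g) v" "v \<in> V" for v
    proof
      assume "v \<in> dvars (C ! i)"
      then have "rk v (leader rk (C ! i))" by (rule leader_max[OF Ci])
      then have "rk v (leader rk g)" using rk_trans[OF v(2) lV _ rl] by simp
      then show False using rk_iff_not_lt[OF v(2) lV(2)] v by simp
    qed
    then have "(fst (leader rk g), snd (leader rk g) + s) \<notin> dvars (C ! i)" if "s > 0" for s
      using lt_same_iff[of "fst (leader rk g)" "snd (leader rk g)" "snd (leader rk g) + s"] lV(2) that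
      by (simp add: dvars_of_def)
    moreover have "deg_in (leader rk g) (C ! i) < deg_in (leader rk g) g"
    proof (cases "leader rk g = leader rk (C ! i)")
      case True
      then show ?thesis using low[OF i] by (auto simp: poly_less_def)
    next
      case False
      then have "leader rk g \<notin> dvars (C ! i)"
        using leader_max[OF Ci, of "leader rk g"] rl rk_antisym[OF lV] by auto
      then show ?thesis
        using leader_in[OF g(2,3)] by (simp add: deg_in_0_iff[symmetric] deg_in_pos_iff[symmetric])
    qed
    ultimately show ?thesis by (simp add: reduced_def)
  qed
  have arD: "reduced rk (C ! i) (C ! j)" if "i < n" "j < n" "i \<noteq> j" for i j
    using ar that nC by (simp add: autoreduced_def)
  have arL: "poly_less rk (C ! i) (C ! j)" if "i < j" "j < n" for i j
    using ar that nC by (simp add: autoreduced_def)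
  have "autoreduced l rk B"
    unfolding autoreduced_def
  proof (intro conjI allI impI ballI)
    show "set B \<subseteq> dring l"
      using ar g set_take_subset[of n C] by (auto simp: autoreduced_def B_def)
    show "\<not> is_const f" if "f \<in> set B" for f
      using that ar g set_take_subset[of n C] by (auto simp: autoreduced_def B_def)
    show "reduced rk (B ! i) (B ! j)" if ij: "i < length B" "j < length B" "i \<noteq> j" for i j
    proof -
      consider "i < n" "j < n" | "i < n" "j = n" | "i = n" "j < n" using ij len by linarith
      then show ?thesis
        by cases (use nC ij red redg arD in \<open>simp_all add: nth_lt nth_n\<close>)
    qed
    show "poly_less rk (B ! i) (B ! j)" if ij: "i < j \<and> j < length B" for i j
    proof -
      consider "i < n" "j < n" | "i < n" "j = n" using ij len by linarith
      then show ?thesis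
        by cases (use nC ij low arL in \<open>simp_all add: nth_lt nth_n\<close>)
    qed
  qed
  moreover have "set B \<subseteq> P" using CP g set_take_subset[of n C] by (auto simp: B_def)
  moreover have "aset_less rk B C"
  proof (cases "n = length C")
    case True
    then show ?thesis using nth_lt len by (auto simp: aset_less_def same_rank_def)
  next
    case False
    then have n: "n < length C" using nC by simp
    have "\<not> poly_less rk (C ! n) g"
      using n nth_length_takeWhile[of "\<lambda>f. poly_less rk f g" C] by (simp add: n_def)
    moreover have "reduced rk g (C ! n)" using red n by simp
    moreover have "leader rk (C ! n) \<in> V" by (rule autoreduced_nth(3)[OF ar n])
    \<comment> \<open>\<open>C ! n\<close> is not below g, so its leader is higher or the same; in
      the latter case reducedness of g makes the degree of g the smaller one.\<close>
    ultimately have "poly_less rk g (C ! n)"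
      using rk_total[of "leader rk (C ! n)" "leader rk g"] leader_V[OF g(2,3)]
      unfolding poly_less_def reduced_def by (metis nat_neq_iff)
    then show ?thesis unfolding aset_less_def
      by (intro disjI1 exI[of _ n]) (simp add: nth_lt nth_n len n same_rank_def)
  qed
  ultimately show False using C by (auto simp: char_set_def)
qed

end

section \<open>The dependence relation of a prime differential ideal\<close>

locale prime_dideal = diff_field \<delta> for \<delta> :: "'k::field_char_0 \<Rightarrow> 'k" +
  fixes l :: nat and P :: "'k dpoly set"
  assumes prime: "prime_diff_ideal \<delta> l P"
begin

lemma P_dring: "f \<in> P \<Longrightarrow> f \<in> dring l"
  and P_0 [simp]: "0 \<in> P"
  and P_add: "f \<in> P \<Longrightarrow> g \<in> P \<Longrightarrow> f + g \<in> P"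
  and P_mult: "f \<in> P \<Longrightarrow> g \<in> dring l \<Longrightarrow> g * f \<in> P"
  and P_d: "f \<in> P \<Longrightarrow> d f \<in> P"
  and P_prime: "f \<in> dring l \<Longrightarrow> g \<in> dring l \<Longrightarrow> f * g \<in> P \<Longrightarrow> f \<in> P \<or> g \<in> P"
  using prime unfolding prime_diff_ideal_def diff_ideal_def by blast+

lemma P_mult_right: "f \<in> P \<Longrightarrow> g \<in> dring l \<Longrightarrow> f * g \<in> P"
  using P_mult[of f g] by (simp add: mult.commute)

lemma P_uminus: "f \<in> P \<Longrightarrow> - f \<in> P"
  using P_mult[of f "-1"] dring_uminus[of 1 l] by simp

lemma P_diff: "f \<in> P \<Longrightarrow> g \<in> P \<Longrightarrow> f - g \<in> P"
  using P_add[of f "- g"] P_uminus[of g] by simp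

lemma P_sum: "(\<And>i. i \<in> A \<Longrightarrow> f i \<in> P) \<Longrightarrow> sum f A \<in> P"
  by (induction A rule: infinite_finite_induct) (auto intro: P_add)

lemma P_diff_iff: "f - g \<in> P \<Longrightarrow> f \<in> P \<longleftrightarrow> g \<in> P"
  using P_add[of "f - g" g] P_diff[of f "f - g"] by auto

lemma not_P_mult: "f \<in> dring l \<Longrightarrow> g \<in> dring l \<Longrightarrow> f \<notin> P \<Longrightarrow> g \<notin> P \<Longrightarrow> f * g \<notin> P"
  using P_prime by blast

lemma const_in_P: "const c \<in> P \<Longrightarrow> c = 0"
proof (rule ccontr)
  assume c: "const c \<in> P" "c \<noteq> 0"
  then have "const (inverse c) * const c \<in> P" using P_mult by simp
  then have "1 \<in> P" using c(2) by (simp add: const_def mult_single)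
  then have "g \<in> P" if "g \<in> dring l" for g using P_mult[of 1 g] that by simp
  then show False using P_dring prime by (auto simp: prime_diff_ideal_def)
qed

lemma one_not_P: "1 \<notin> P"
  using const_in_P[of 1] by (auto simp: const_def)

text \<open>Vectors indexed by derivatives and read modulo P represent elements of the module of
  Kaehler differentials over the fraction field of R/P; N consists of the relations between the
  differentials of the derivatives.\<close>

inductive_set N :: "(dvar \<Rightarrow> 'k dpoly) set" where
  grad: "f \<in> P \<Longrightarrow> (\<lambda>v. pd v f) \<in> N"
| N_add: "\<omega> \<in> N \<Longrightarrow> \<eta> \<in> N \<Longrightarrow> (\<lambda>v. \<omega> v + \<eta> v) \<in> N"
| N_scale: "a \<in> dring l \<Longrightarrow> \<omega> \<in> N \<Longrightarrow> (\<lambda>v. a * \<omega> v) \<in> N"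

lemma N_dring: "\<omega> \<in> N \<Longrightarrow> \<omega> v \<in> dring l"
  by (induction rule: N.induct) (auto intro: P_dring)

lemma N_finite_support: "\<omega> \<in> N \<Longrightarrow> finite {v. \<omega> v \<notin> P}"
proof (induction rule: N.induct)
  case (grad f)
  have "{v. pd v f \<notin> P} \<subseteq> dvars f" using in_dvars_iff_pd[of _ f] by auto
  then show ?case using finite_dvars finite_subset by blast
next
  case (N_add \<omega> \<eta>)
  have "{v. \<omega> v + \<eta> v \<notin> P} \<subseteq> {v. \<omega> v \<notin> P} \<union> {v. \<eta> v \<notin> P}" using P_add by blast
  then show ?case by (rule finite_subset) (use N_add.IH in simp)
next
  case (N_scale a \<omega>)
  have "{v. a * \<omega> v \<notin> P} \<subseteq> {v. \<omega> v \<notin> P}" using P_mult N_scale.hyps(1) by blast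
  then show ?case by (rule finite_subset) (use N_scale.IH in simp)
qed

text \<open>If \<omega> stands for the sum of \<omega> v times the differential of v, this is its
  derivative by the Leibniz rule: coefficients are differentiated, and the differential of v becomes
  that of \<open>dshift v\<close>.\<close>

definition D :: "(dvar \<Rightarrow> 'k dpoly) \<Rightarrow> dvar \<Rightarrow> 'k dpoly" where
  "D \<omega> = (\<lambda>(j, r). d (\<omega> (j, r)) + (case r of 0 \<Rightarrow> 0 | Suc q \<Rightarrow> \<omega> (j, q)))"

lemma D_simps: "D \<omega> (j, 0) = d (\<omega> (j, 0))" "D \<omega> (j, Suc q) = d (\<omega> (j, Suc q)) + \<omega> (j, q)"
  by (simp_all add: D_def)

text \<open>On gradients the commutator rules turn \<open>D\<close> into the gradient of
  \<open>d f\<close>, with \<open>d f\<close> again in P; on multiples the Leibniz rule leaves a sum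
  of two elements of N.\<close>

lemma N_D: "\<omega> \<in> N \<Longrightarrow> D \<omega> \<in> N"
proof (induction rule: N.induct)
  case (grad f)
  have "D (\<lambda>v. pd v f) = (\<lambda>v. pd v (d f))"
    by (auto simp: D_def fun_eq_iff pd_d_0 pd_d_Suc split: nat.split)
  then show ?case using N.grad[OF P_d[OF grad]] by simp
next
  case (N_add \<omega> \<eta>)
  have "D (\<lambda>v. \<omega> v + \<eta> v) = (\<lambda>v. D \<omega> v + D \<eta> v)"
    by (auto simp: D_def fun_eq_iff d_add split: nat.split)
  then show ?case using N.N_add[OF N_add.IH] by simp
next
  case (N_scale a \<omega>)
  have "D (\<lambda>v. a * \<omega> v) = (\<lambda>v. d a * \<omega> v + a * D \<omega> v)"
    by (auto simp: D_def fun_eq_iff d_mult algebra_simps split: nat.split)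
  moreover have "(\<lambda>v. d a * \<omega> v + a * D \<omega> v) \<in> N"
    by (rule N.N_add) (use N_scale in \<open>auto intro: N.N_scale\<close>)
  ultimately show ?case by simp
qed

lemma D_support:
  assumes "D \<omega> w \<notin> P"
  shows "\<omega> w \<notin> P \<or> (\<exists>w'. w = dshift w' \<and> \<omega> w' \<notin> P)"
proof (cases w)
  case (Pair j r)
  then show ?thesis
    using assms by (cases r) (auto simp: D_simps dshift_def dest: P_d P_add)
qed

text \<open>At the front of a relation, differentiation moves the coefficient from v to
  \<open>dshift v\<close> unchanged modulo P, so a nonzero front coefficient never dies.
  Nontriviality in \<open>dep_dshift\<close> and \<open>bounded_by_h\<close> rests on this.\<close>

lemma D_dshift:
  assumes "\<omega> (dshift v) \<in> P"
  shows "D \<omega> (dshift v) \<in> P \<longleftrightarrow> \<omega> v \<in> P"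
proof -
  obtain j r where [simp]: "v = (j, r)" by (cases v)
  have "D \<omega> (dshift v) - \<omega> v = d (\<omega> (dshift v))" by (simp add: D_simps dshift_def)
  then show ?thesis using P_diff_iff P_d[OF assms] by simp
qed

text \<open>Linear dependence of the differential of v on those of S, cleared of denominators.
  Membership is listed separately because the relation expressing v by itself is trivial and need
  not be witnessed in N.\<close>

definition dep :: "dvar \<Rightarrow> dvar set \<Rightarrow> bool" where
  "dep v S \<longleftrightarrow> v \<in> S \<or> (\<exists>\<omega>\<in>N. \<omega> v \<notin> P \<and> (\<forall>w. w \<noteq> v \<longrightarrow> w \<notin> S \<longrightarrow> \<omega> w \<in> P))"

lemma depI: "\<omega> \<in> N \<Longrightarrow> \<omega> v \<notin> P \<Longrightarrow> (\<And>w. w \<noteq> v \<Longrightarrow> w \<notin> S \<Longrightarrow> \<omega> w \<in> P) \<Longrightarrow> dep v S"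
  unfolding dep_def by blast

lemma depE:
  assumes "dep v S" "v \<notin> S"
  obtains \<omega> where "\<omega> \<in> N" "\<omega> v \<notin> P" "\<And>w. w \<noteq> v \<Longrightarrow> w \<notin> S \<Longrightarrow> \<omega> w \<in> P"
  using assms unfolding dep_def by blast

text \<open>Gaussian elimination: each w in the support outside T and v is removed with the help of
  its own relation, and the number of such w decreases.\<close>

lemma dep_eliminate:
  assumes "\<omega> \<in> N" "v \<notin> T" "\<omega> v \<notin> P" "\<And>w. w \<noteq> v \<Longrightarrow> \<omega> w \<notin> P \<Longrightarrow> dep w T"
  shows "dep v T"
  using assms(1,3,4)
proof (induction "card {w. w \<noteq> v \<and> w \<notin> T \<and> \<omega> w \<notin> P}" arbitrary: \<omega> rule: less_induct)
  case less
  show ?case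
  proof (cases "\<exists>w. w \<noteq> v \<and> w \<notin> T \<and> \<omega> w \<notin> P")
    case False
    then show ?thesis using less.prems by (intro depI) blast+
  next
    case True
    then obtain w where w: "w \<noteq> v" "w \<notin> T" "\<omega> w \<notin> P" by blast
    have "dep w T" using less.prems(3) w by simp
    then obtain \<eta> where \<eta>: "\<eta> \<in> N" "\<eta> w \<notin> P" "\<And>u. u \<noteq> w \<Longrightarrow> u \<notin> T \<Longrightarrow> \<eta> u \<in> P"
      using w(2) by (rule depE) (rule that)
    \<comment> \<open>Cross-multiplication cancels the entry at w. At v only the first summand
      counts modulo P, and primality keeps it outside P.\<close>
    define \<omega>' where "\<omega>' u = \<eta> w * \<omega> u + (- \<omega> w) * \<eta> u" for u
    have dr: "\<eta> u \<in> dring l" "\<omega> u \<in> dring l" "- \<omega> u \<in> dring l" for u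
      by (intro dring_uminus N_dring \<eta>(1) less.prems(1))+
    have "\<omega>' \<in> N" unfolding \<omega>'_def
      by (intro N_add N_scale dr \<eta>(1) less.prems(1))
    moreover have supp: "\<omega> u \<notin> P" if "\<omega>' u \<notin> P" "u \<notin> T" "u \<noteq> w" for u
    proof
      assume "\<omega> u \<in> P"
      then have "\<eta> w * \<omega> u \<in> P" "- \<omega> w * \<eta> u \<in> P"
        using P_mult[of "\<omega> u" "\<eta> w"] P_mult[of "\<eta> u" "- \<omega> w"] \<eta>(3)[of u] that dr by blast+
      then show False using that P_add unfolding \<omega>'_def by blast
    qed
    moreover have "\<omega>' v \<notin> P"
    proof
      assume "\<omega>' v \<in> P"
      moreover have "- \<omega> w * \<eta> v \<in> P" using P_mult[of "\<eta> v" "- \<omega> w"] \<eta>(3)[of v] w assms(2) dr by blast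
      ultimately have "\<eta> w * \<omega> v \<in> P" using P_diff[of "\<omega>' v" "- \<omega> w * \<eta> v"] unfolding \<omega>'_def add_diff_cancel_right' by blast
      then show False using P_prime[OF dr(1,2)] \<eta>(2) less.prems(2) by blast
    qed
    moreover have w0: "\<omega>' w = 0" by (simp add: \<omega>'_def)
    moreover have "card {u. u \<noteq> v \<and> u \<notin> T \<and> \<omega>' u \<notin> P} < card {u. u \<noteq> v \<and> u \<notin> T \<and> \<omega> u \<notin> P}"
    proof (rule psubset_card_mono)
      show "finite {u. u \<noteq> v \<and> u \<notin> T \<and> \<omega> u \<notin> P}"
        using N_finite_support[OF less.prems(1)] by (rule rev_finite_subset) auto
      have "\<omega> u \<notin> P" if "u \<notin> T" "\<omega>' u \<notin> P" for u
        using supp[of u] that w0 by (cases "u = w") auto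
      then have "{u. u \<noteq> v \<and> u \<notin> T \<and> \<omega>' u \<notin> P} \<subseteq> {u. u \<noteq> v \<and> u \<notin> T \<and> \<omega> u \<notin> P}" by blast
      moreover have "w \<in> {u. u \<noteq> v \<and> u \<notin> T \<and> \<omega> u \<notin> P}" "w \<notin> {u. u \<noteq> v \<and> u \<notin> T \<and> \<omega>' u \<notin> P}"
        using w w0 by simp_all
      ultimately show "{u. u \<noteq> v \<and> u \<notin> T \<and> \<omega>' u \<notin> P} \<subset> {u. u \<noteq> v \<and> u \<notin> T \<and> \<omega> u \<notin> P}" by blast
    qed
    moreover have "dep u T" if "u \<noteq> v" "\<omega>' u \<notin> P" for u
    proof (cases "u \<in> T")
      case True
      then show ?thesis by (simp add: dep_def)
    next
      case False
      have "u \<noteq> w" using that w0 by auto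
      then show ?thesis using less.prems(3)[of u] supp[of u] that False by blast
    qed
    ultimately show ?thesis using less.hyps[of \<omega>'] by blast
  qed
qed

text \<open>Transitivity is elimination. For exchange the same relation serves: its coefficient at w
  is outside P, since otherwise it would make v depend on S alone.\<close>

sublocale dependence_relation dep
proof
  show "dep v S" if "v \<in> S" for v S using that by (simp add: dep_def)
  show "dep v T" if "dep v S" and ST: "\<And>s. s \<in> S \<Longrightarrow> dep s T" for v S T
  proof (cases "v \<in> S \<or> v \<in> T")
    case True
    then show ?thesis using ST[of v] by (auto simp: dep_def[of v T])
  next
    case False
    then have "v \<notin> S" by simp
    with \<open>dep v S\<close> obtain \<omega> where \<omega>: "\<omega> \<in> N" "\<omega> v \<notin> P" "\<And>w. w \<noteq> v \<Longrightarrow> w \<notin> S \<Longrightarrow> \<omega> w \<in> P"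
      by (rule depE) (rule that)
    have "dep w T" if "w \<noteq> v" "\<omega> w \<notin> P" for w using ST[of w] \<omega>(3)[of w] that by blast
    then show ?thesis using dep_eliminate[OF \<omega>(1) _ \<omega>(2)] False by simp
  qed
  show "dep w (insert v S)" if "dep v (insert w S)" "\<not> dep v S" for v w S
  proof (cases "v = w")
    case True
    then show ?thesis by (simp add: dep_def)
  next
    case False
    then have "v \<notin> insert w S" using that(2) dep_def by blast
    with that(1) obtain \<omega> where \<omega>: "\<omega> \<in> N" "\<omega> v \<notin> P" "\<And>u. u \<noteq> v \<Longrightarrow> u \<notin> insert w S \<Longrightarrow> \<omega> u \<in> P"
      by (rule depE) (rule that)
    have "\<omega> w \<notin> P"
    proof
      assume "\<omega> w \<in> P"
      then have "\<omega> u \<in> P" if "u \<noteq> v" "u \<notin> S" for u using \<omega>(3)[of u] that by (cases "u = w") simp_all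
      then show False using that(2) depI[OF \<omega>(1,2), of S] by simp
    qed
    moreover have "\<omega> u \<in> P" if "u \<noteq> w" "u \<notin> insert v S" for u
      using \<omega>(3)[of u] that by simp
    ultimately show ?thesis using \<omega>(1) by (intro depI[of \<omega>])
  qed
qed

lemma dep_dshift:
  assumes "dep v S"
  shows "dep (dshift v) (insert v (S \<union> dshift ` S))"
proof (cases "v \<in> S \<or> dshift v \<in> S")
  case True
  then show ?thesis by (auto intro: dep_mem)
next
  case False
  then have "v \<notin> S" by simp
  with assms obtain \<omega> where \<omega>: "\<omega> \<in> N" "\<omega> v \<notin> P" "\<And>w. w \<noteq> v \<Longrightarrow> w \<notin> S \<Longrightarrow> \<omega> w \<in> P"
    by (rule depE) (rule that)
  have "dshift v \<noteq> v" by (simp add: dshift_def prod_eq_iff)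
  then have "D \<omega> (dshift v) \<notin> P" using D_dshift[of \<omega> v] \<omega>(2) \<omega>(3)[of "dshift v"] False by simp
  moreover have "D \<omega> w \<in> P" if "w \<noteq> dshift v" "w \<notin> insert v (S \<union> dshift ` S)" for w
    using D_support[of \<omega> w] \<omega>(3) that by (metis image_eqI insertCI UnCI)
  ultimately show ?thesis using N_D[OF \<omega>(1)] by (intro depI[of "D \<omega>"])
qed

end

section \<open>Ritt reduction by a characteristic set\<close>

lemma reduced_mono:
  assumes "reduced rk f g" "\<And>w. deg_in w f' \<le> deg_in w f"
  shows "reduced rk f' g"
proof -
  have "w \<in> dvars f" if "w \<in> dvars f'" for w
    using that assms(2)[of w] by (simp add: deg_in_pos_iff[symmetric])
  then show ?thesis using assms(1) assms(2)[of "leader rk g"] unfolding reduced_def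
    by (meson le_less_trans)
qed

lemma deg_in_le_Suc_pd: "deg_in v f \<le> Suc (deg_in v (pd v f))"
  unfolding deg_in_le_iff
proof
  fix m assume m: "m \<in> Poly_Mapping.keys f"
  show "Poly_Mapping.lookup m v \<le> Suc (deg_in v (pd v f))"
  proof (cases "Poly_Mapping.lookup m v")
    case (Suc n)
    define m' where "m' = m - Poly_Mapping.single v 1"
    have "m' + Poly_Mapping.single v 1 = m"
      using Suc by (intro poly_mapping_eqI) (auto simp: m'_def lookup_add lookup_minus lookup_single when_def)
    then have "Poly_Mapping.lookup (pd v f) m' \<noteq> 0"
      using m unfolding lookup_pd by (simp add: in_keys_iff del: of_nat_Suc)
    then have "Poly_Mapping.lookup m' v \<le> deg_in v (pd v f)"
      using deg_in_le_iff[of v "pd v f" "deg_in v (pd v f)"] by (simp add: in_keys_iff)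
    then show ?thesis using Suc by (simp add: m'_def lookup_minus)
  qed simp
qed

locale charset = prime_dideal \<delta> l P + ranked l rk
  for \<delta> :: "'k::field_char_0 \<Rightarrow> 'k" and l P rk +
  fixes C :: "'k dpoly list"
  assumes char_set: "char_set l rk P C"
begin

abbreviation le :: "'k dpoly \<Rightarrow> dvar" where "le f \<equiv> leader rk f"

lemma C_autoreduced: "autoreduced l rk C" and C_P: "f \<in> set C \<Longrightarrow> f \<in> P"
  using char_set by (auto simp: char_set_def)

lemma
  assumes "f \<in> set C"
  shows C_dring: "f \<in> dring l" and C_le_V: "le f \<in> V" and C_le_in: "le f \<in> dvars f"
    and C_le_max: "w \<in> dvars f \<Longrightarrow> rk w (le f)"
proof -
  have f: "f \<in> dring l" "\<not> is_const f" using C_autoreduced assms by (auto simp: autoreduced_def)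
  show "f \<in> dring l" "le f \<in> V" "le f \<in> dvars f" "w \<in> dvars f \<Longrightarrow> rk w (le f)"
    using f leader_V leader_in leader_max by blast+
qed

lemma C_reduced:
  assumes "f \<in> set C" "g \<in> set C" "f \<noteq> g"
  shows "reduced rk f g"
proof -
  obtain a b where "a < length C" "b < length C" "C ! a = f" "C ! b = g"
    using assms by (auto simp: in_set_conv_nth)
  then show ?thesis using C_autoreduced assms(3) by (auto simp: autoreduced_def)
qed

lemma C_fst_inj:
  assumes "f \<in> set C" "g \<in> set C" "fst (le f) = fst (le g)"
  shows "f = g"
proof -
  obtain a b where "a < length C" "b < length C" "C ! a = f" "C ! b = g"
    using assms by (auto simp: in_set_conv_nth)
  then show ?thesis using autoreduced_fst_leader[OF C_autoreduced, of a b] assms(3) by auto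
qed

text \<open>Constants are excluded from autoreduced sets and are treated apart: a constant in P
  vanishes because P is proper.\<close>

lemma no_reduced:
  assumes "g \<in> P" "\<And>f. f \<in> set C \<Longrightarrow> reduced rk g f"
  shows "g = 0"
proof (cases "is_const g")
  case True
  then obtain c where "g = const c" using dvars_empty_imp_const by (auto simp: is_const_def)
  then have "c = 0" using assms(1) const_in_P by simp
  then show ?thesis using \<open>g = const c\<close> by (simp add: const_def)
next
  case False
  then show ?thesis using char_set_no_reduced[OF char_set assms(1) P_dring[OF assms(1)]] assms(2) by blast
qed

lemma lt_le_not_in: "f \<in> set C \<Longrightarrow> w \<in> V \<Longrightarrow> lt (le f) w \<Longrightarrow> w \<notin> dvars f"
  using C_le_max[of f w] rk_iff_not_lt[of w "le f"] C_le_V[of f] by blast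

lemma no_proper_derivative:
  assumes "f \<in> set C" "s > 0"
  shows "(fst (le f), snd (le f) + s) \<notin> dvars f"
proof -
  have "fst (le f) < l" using C_le_V[OF assms(1)] by (simp add: dvars_of_def)
  then show ?thesis
    using lt_le_not_in[OF assms(1), of "(fst (le f), snd (le f) + s)"]
      lt_same_iff[of "fst (le f)" "snd (le f)" "snd (le f) + s"] assms(2)
    by (simp add: dvars_of_def)
qed

text \<open>The common reason why initials and separants of members of C lie outside P: such a g is
  reduced with respect to every member.\<close>

lemma lower_not_in_P:
  assumes "f \<in> set C" "g \<noteq> 0" "\<And>w. deg_in w g \<le> deg_in w f" "deg_in (le f) g < deg_in (le f) f"
  shows "g \<notin> P"
proof
  assume "g \<in> P"
  moreover have "reduced rk g h" if "h \<in> set C" for h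
  proof (cases "h = f")
    case True
    have "w \<in> dvars f" if "w \<in> dvars g" for w
      using that assms(3)[of w] by (simp add: deg_in_pos_iff[symmetric])
    then show ?thesis
      using True no_proper_derivative[OF assms(1)] assms(4) by (auto simp: reduced_def)
  next
    case False
    then show ?thesis using C_reduced[OF assms(1) that] reduced_mono assms(3) by blast
  qed
  ultimately show False using no_reduced assms(2) by blast
qed

lemma separant_not_in_P: "f \<in> set C \<Longrightarrow> pd (le f) f \<notin> P"
  using C_le_in[of f] lower_not_in_P[of f "pd (le f) f", OF _ _ deg_in_pd deg_in_pd_less]
  by (simp add: in_dvars_iff_pd)

section \<open>Elements of P led by the derivatives of leaders\<close>

definition L :: "dvar set" where
  "L = {v. \<exists>f\<in>set C. fst v = fst (le f) \<and> snd (le f) \<le> snd v}"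

lemma L_V: "L \<subseteq> V"
proof
  fix v assume "v \<in> L"
  then obtain f where "f \<in> set C" "fst v = fst (le f)" by (auto simp: L_def)
  then show "v \<in> V" using C_le_V[of f] by (simp add: dvars_of_def)
qed

lemma L_le: "f \<in> set C \<Longrightarrow> le f \<in> L"
  by (auto simp: L_def)

text \<open>An element of P with leader v, fit for pseudo-division: initial and separant lie outside
  P. The last clause keeps its degree in v so low, namely 1 at a proper derivative of a leader, that
  being below all pivots implies being reduced with respect to C
  (\<open>reduced_if_below_G\<close>).\<close>

definition pivot :: "dvar \<Rightarrow> 'k dpoly \<Rightarrow> bool" where
  "pivot v g \<longleftrightarrow> g \<in> P \<and> (\<forall>w\<in>dvars g. rk w v) \<and> pd v g \<notin> P
     \<and> (\<exists>c g0. g = c * X v ^ deg_in v g + g0 \<and> deg_in v c = 0 \<and> c \<notin> P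
          \<and> deg_in v g0 < deg_in v g \<and> (\<forall>w. deg_in w c \<le> deg_in w g) \<and> (\<forall>w. deg_in w g0 \<le> deg_in w g))
     \<and> deg_in v g > 0
     \<and> (\<forall>f\<in>set C. if le f = v then deg_in v g \<le> deg_in v f
            else fst v = fst (le f) \<longrightarrow> deg_in v g \<le> 1)"

lemma pivot_C:
  assumes f: "f \<in> set C"
  shows "pivot (le f) f"
proof -
  let ?v = "le f"
  obtain c f0 where c: "f = c * X ?v ^ deg_in ?v f + f0" "deg_in ?v c = 0"
    "\<And>m. m \<in> Poly_Mapping.keys f0 \<Longrightarrow> Poly_Mapping.lookup m ?v < deg_in ?v f"
    "\<And>w. deg_in w c \<le> deg_in w f" "\<And>w. deg_in w f0 \<le> deg_in w f"
    using leading_coeff_decomp[of f ?v] by blast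
  have pos: "0 < deg_in ?v f" using C_le_in[OF f] by (simp add: deg_in_pos_iff)
  have d0: "deg_in ?v f0 < deg_in ?v f" using deg_in_less_iff[OF pos] c(3) by blast
  have "c \<noteq> 0" using c(1) d0 by auto
  then have "c \<notin> P" using lower_not_in_P[OF f, of c] c(2,4) pos by simp
  moreover have "if le h = ?v then deg_in ?v f \<le> deg_in ?v h
            else fst ?v = fst (le h) \<longrightarrow> deg_in ?v f \<le> 1" if "h \<in> set C" for h
    using C_fst_inj[OF f that] by (cases "fst ?v = fst (le h)") auto
  ultimately show ?thesis unfolding pivot_def
    using c(1,2,4,5) d0 pos C_P[OF f] C_le_max[OF f] separant_not_in_P[OF f] by blast
qed

lemma derivatives_C:
  assumes f: "f \<in> set C"
  shows "(d ^^ i) f \<in> P \<and> (\<forall>w\<in>dvars ((d ^^ i) f). rk w (fst (le f), snd (le f) + i))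
    \<and> pd (fst (le f), snd (le f) + i) ((d ^^ i) f) = pd (le f) f"
proof (induction i)
  case 0
  then show ?case using C_P[OF f] C_le_max[OF f] by simp
next
  case (Suc i)
  let ?g = "(d ^^ i) f" and ?u = "(fst (le f), snd (le f) + i)"
  have jl: "fst (le f) < l" using C_le_V[OF f] by (simp add: dvars_of_def)
  have g: "?g \<in> P" "\<And>w. w \<in> dvars ?g \<Longrightarrow> rk w ?u" "pd ?u ?g = pd (le f) f" using Suc by auto
  have gV: "dvars ?g \<subseteq> V" using P_dring[OF g(1)] by (simp add: dring_dvars)
  have uV: "?u \<in> V" using jl by (simp add: dvars_of_def)
  have su: "dshift ?u = (fst (le f), snd (le f) + Suc i)" by (simp add: dshift_def)
  have "rk w (dshift ?u)" if "w \<in> dvars (d ?g)" for w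
    using dvars_d[OF that]
  proof
    assume w: "w \<in> dvars ?g"
    then show ?thesis using rk_trans[of w ?u "dshift ?u"] g(2)[OF w] rk_dshift[OF uV] gV uV by auto
  next
    assume "\<exists>w'\<in>dvars ?g. w = dshift w'"
    then obtain w' where "w' \<in> dvars ?g" "w = dshift w'" by blast
    then show ?thesis using g(2) gV rk_dshift_mono[OF _ uV, of w'] by auto
  qed
  \<comment> \<open>Everything in \<open>?g\<close> ranks below \<open>dshift ?u\<close>, so of the
    two terms in \<open>pd_d_Suc\<close> only \<open>pd ?u ?g\<close> remains: the separant is
    inherited.\<close>
  moreover have "dshift ?u \<notin> dvars ?g"
  proof
    assume "dshift ?u \<in> dvars ?g"
    then have "rk (dshift ?u) ?u" by (rule g(2))
    then show False using lt_dshift[OF uV] rk_iff_not_lt[of "dshift ?u" ?u] uV by simp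
  qed
  then have "pd (dshift ?u) (d ?g) = pd (le f) f"
    using g(3) by (simp add: dshift_def pd_d_Suc in_dvars_iff_pd)
  ultimately show ?case using P_d[OF g(1)] by (simp add: su)
qed

text \<open>A proper derivative is linear in its leader: its partial derivative there is the
  separant of f, in which the new leader does not occur. Hence that separant is also the
  initial.\<close>

lemma pivot_derivative:
  assumes f: "f \<in> set C" and i: "i > 0"
  shows "pivot (fst (le f), snd (le f) + i) ((d ^^ i) f)"
proof -
  let ?g = "(d ^^ i) f" and ?v = "(fst (le f), snd (le f) + i)"
  have g: "?g \<in> P" "\<And>w. w \<in> dvars ?g \<Longrightarrow> rk w ?v" "pd ?v ?g = pd (le f) f"
    using derivatives_C[OF f, of i] by auto
  have pdP: "pd ?v ?g \<notin> P" using separant_not_in_P[OF f] by (simp add: g(3))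
  have vf: "?v \<notin> dvars f" using no_proper_derivative[OF f i] .
  then have vp: "?v \<notin> dvars (pd ?v ?g)" unfolding g(3) using dvars_pd[of "le f" f] by blast
  then have "deg_in ?v ?g \<le> 1" using deg_in_le_Suc_pd[of ?v ?g] by (simp add: deg_in_0_iff[symmetric])
  moreover have "pd ?v ?g \<noteq> 0" using pdP by auto
  then have "0 < deg_in ?v ?g" by (simp add: deg_in_pos_iff in_dvars_iff_pd)
  ultimately have deg: "deg_in ?v ?g = 1" by simp
  obtain c g0 where c: "?g = c * X ?v ^ deg_in ?v ?g + g0" "deg_in ?v c = 0"
    "\<And>m. m \<in> Poly_Mapping.keys g0 \<Longrightarrow> Poly_Mapping.lookup m ?v < deg_in ?v ?g"
    "\<And>w. deg_in w c \<le> deg_in w ?g" "\<And>w. deg_in w g0 \<le> deg_in w ?g"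
    using leading_coeff_decomp[of ?g ?v] by blast
  have d0: "deg_in ?v g0 < deg_in ?v ?g" using deg_in_less_iff[of 1 ?v g0] c(3) deg by simp
  have "pd ?v c = 0" "pd ?v g0 = 0"
    using c(2) d0 deg deg_in_0_iff[of ?v c] deg_in_0_iff[of ?v g0] by (simp_all add: in_dvars_iff_pd)
  moreover have "pd ?v ?g = pd ?v (c * X ?v + g0)" using c(1) deg by simp
  ultimately have "pd ?v ?g = c" by (simp add: pd_add pd_mult pd_X)
  then have "c \<notin> P" using pdP by simp
  moreover have "if le h = ?v then deg_in ?v ?g \<le> deg_in ?v h
            else fst ?v = fst (le h) \<longrightarrow> deg_in ?v ?g \<le> 1" if "h \<in> set C" for h
  proof -
    have "le h \<noteq> ?v"
    proof
      assume e: "le h = ?v"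
      then have "f = h" using C_fst_inj[OF f that] by simp
      then show False using e i by (simp add: prod_eq_iff)
    qed
    then show ?thesis using deg by (metis order_refl)
  qed
  moreover have "0 < deg_in ?v ?g" using deg by simp
  ultimately show ?thesis unfolding pivot_def
    using c(1,2,4,5) d0 g(1,2) pdP by blast
qed

lemma pivot_exists: "v \<in> L \<Longrightarrow> \<exists>g. pivot v g"
proof -
  assume "v \<in> L"
  then obtain f where f: "f \<in> set C" "fst v = fst (le f)" "snd (le f) \<le> snd v" by (auto simp: L_def)
  show ?thesis
  proof (cases "snd v = snd (le f)")
    case True
    then have "v = le f" using f by (simp add: prod_eq_iff)
    then show ?thesis using pivot_C[OF f(1)] by blast
  next
    case False
    then have "v = (fst (le f), snd (le f) + (snd v - snd (le f)))" using f by (simp add: prod_eq_iff)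
    then show ?thesis using pivot_derivative[OF f(1), of "snd v - snd (le f)"] False f(3) by auto
  qed
qed

definition G :: "dvar \<Rightarrow> 'k dpoly" where "G v = (SOME g. pivot v g)"

lemma pivot_G: "v \<in> L \<Longrightarrow> pivot v (G v)"
  unfolding G_def using someI_ex[OF pivot_exists] .

lemma G_P: "v \<in> L \<Longrightarrow> G v \<in> P"
  and G_le: "v \<in> L \<Longrightarrow> w \<in> dvars (G v) \<Longrightarrow> rk w v"
  and G_pd: "v \<in> L \<Longrightarrow> pd v (G v) \<notin> P"
  and G_deg: "v \<in> L \<Longrightarrow> deg_in v (G v) > 0"
  using pivot_G unfolding pivot_def by blast+

lemma reduced_if_below_G:
  assumes "\<And>v. v \<in> L \<Longrightarrow> deg_in v f < deg_in v (G v)" "h \<in> set C"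
  shows "reduced rk f h"
  unfolding reduced_def
proof (intro conjI allI impI)
  fix s :: nat assume "s > 0"
  let ?v = "(fst (le h), snd (le h) + s)"
  have vL: "?v \<in> L" using assms(2) by (auto simp: L_def)
  have "le h \<noteq> ?v" using \<open>s > 0\<close> by (simp add: prod_eq_iff)
  then have "deg_in ?v (G ?v) \<le> 1"
    using pivot_G[OF vL] assms(2) unfolding pivot_def by auto
  then have "deg_in ?v f = 0" using assms(1)[OF vL] by simp
  then show "?v \<notin> dvars f" by (simp add: deg_in_0_iff)
next
  have "deg_in (le h) (G (le h)) \<le> deg_in (le h) h"
    using pivot_G[OF L_le[OF assms(2)]] assms(2) unfolding pivot_def by auto
  then show "deg_in (le h) f < deg_in (le h) h" using assms(1)[OF L_le[OF assms(2)]] by simp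
qed

text \<open>The span of the gradients of the pivots over the fraction field of R/P, with a as common
  denominator.\<close>

definition spanned :: "(dvar \<Rightarrow> 'k dpoly) \<Rightarrow> bool" where
  "spanned \<omega> \<longleftrightarrow> (\<exists>a U c. a \<in> dring l \<and> a \<notin> P \<and> finite U \<and> U \<subseteq> L \<and> (\<forall>u. c u \<in> dring l)
     \<and> (\<forall>w. a * \<omega> w - (\<Sum>u\<in>U. c u * pd w (G u)) \<in> P))"

lemma spanned_0: "spanned (\<lambda>w. 0)"
  unfolding spanned_def by (intro exI[of _ 1] exI[of _ "{}"] exI[of _ "\<lambda>_. 0"]) (simp add: one_not_P)

lemma spanned_single:
  assumes "v \<in> L"
  shows "spanned (\<lambda>w. pd w (G v))"
  unfolding spanned_def
  by (intro exI[of _ 1] exI[of _ "{v}"] exI[of _ "\<lambda>_. 1"]) (use assms in \<open>simp add: one_not_P\<close>)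

lemma spanned_scale:
  assumes "spanned \<omega>" "x \<in> dring l"
  shows "spanned (\<lambda>w. x * \<omega> w)"
proof -
  obtain a U c where *: "a \<in> dring l" "a \<notin> P" "finite U" "U \<subseteq> L" "\<And>u. c u \<in> dring l"
    "\<And>w. a * \<omega> w - (\<Sum>u\<in>U. c u * pd w (G u)) \<in> P"
    using assms(1) unfolding spanned_def by blast
  have "a * (x * \<omega> w) - (\<Sum>u\<in>U. (x * c u) * pd w (G u)) \<in> P" for w
  proof -
    have "a * (x * \<omega> w) - (\<Sum>u\<in>U. (x * c u) * pd w (G u)) = x * (a * \<omega> w - (\<Sum>u\<in>U. c u * pd w (G u)))"
      by (simp add: right_diff_distrib sum_distrib_left mult.assoc mult.left_commute)
    then show ?thesis using P_mult[OF *(6) assms(2)] by simp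
  qed
  then show ?thesis unfolding spanned_def
    using *(1-5) assms(2) by (intro exI[of _ a] exI[of _ U] exI[of _ "\<lambda>u. x * c u"]) blast
qed

lemma spanned_add:
  assumes "spanned \<omega>" "spanned \<eta>"
  shows "spanned (\<lambda>w. \<omega> w + \<eta> w)"
proof -
  obtain a U c where *: "a \<in> dring l" "a \<notin> P" "finite U" "U \<subseteq> L" "\<And>u. c u \<in> dring l"
    "\<And>w. a * \<omega> w - (\<Sum>u\<in>U. c u * pd w (G u)) \<in> P"
    using assms(1) unfolding spanned_def by blast
  obtain b W e where **: "b \<in> dring l" "b \<notin> P" "finite W" "W \<subseteq> L" "\<And>u. e u \<in> dring l"
    "\<And>w. b * \<eta> w - (\<Sum>u\<in>W. e u * pd w (G u)) \<in> P"
    using assms(2) unfolding spanned_def by blast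
  define k where "k u = (if u \<in> U then b * c u else 0) + (if u \<in> W then a * e u else 0)" for u
  have kd: "k u \<in> dring l" for u unfolding k_def
    using dring_mult[OF **(1) *(5)[of u]] dring_mult[OF *(1) **(5)[of u]] by (intro dring_add) simp_all
  have sum: "(\<Sum>u\<in>U \<union> W. k u * pd w (G u))
      = b * (\<Sum>u\<in>U. c u * pd w (G u)) + a * (\<Sum>u\<in>W. e u * pd w (G u))" for w
  proof -
    have "(\<Sum>u\<in>U \<union> W. k u * pd w (G u)) = (\<Sum>u\<in>U \<union> W. if u \<in> U then b * (c u * pd w (G u)) else 0)
        + (\<Sum>u\<in>U \<union> W. if u \<in> W then a * (e u * pd w (G u)) else 0)"
      unfolding sum.distrib[symmetric] k_def by (intro sum.cong) (auto simp: algebra_simps)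
    also have "(\<Sum>u\<in>U \<union> W. if u \<in> U then b * (c u * pd w (G u)) else 0) = (\<Sum>u\<in>U. b * (c u * pd w (G u)))"
      using *(3) **(3) by (intro sum.mono_neutral_cong_right) auto
    also have "(\<Sum>u\<in>U \<union> W. if u \<in> W then a * (e u * pd w (G u)) else 0) = (\<Sum>u\<in>W. a * (e u * pd w (G u)))"
      using *(3) **(3) by (intro sum.mono_neutral_cong_right) auto
    finally show ?thesis by (simp add: sum_distrib_left)
  qed
  have "(a * b) * (\<omega> w + \<eta> w) - (\<Sum>u\<in>U \<union> W. k u * pd w (G u)) \<in> P" for w
  proof -
    have "(a * b) * (\<omega> w + \<eta> w) - (\<Sum>u\<in>U \<union> W. k u * pd w (G u))
      = b * (a * \<omega> w - (\<Sum>u\<in>U. c u * pd w (G u))) + a * (b * \<eta> w - (\<Sum>u\<in>W. e u * pd w (G u)))"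
      unfolding sum by (simp add: algebra_simps)
    then show ?thesis using P_add[OF P_mult[OF *(6) **(1)] P_mult[OF **(6) *(1)]] by simp
  qed
  moreover have "a * b \<notin> P" "a * b \<in> dring l" using not_P_mult * ** by auto
  moreover have "finite (U \<union> W)" "U \<union> W \<subseteq> L" using * ** by auto
  ultimately show ?thesis unfolding spanned_def
    using kd by (intro exI[of _ "a * b"] exI[of _ "U \<union> W"] exI[of _ k]) blast
qed

lemma spanned_cancel:
  assumes "spanned \<omega>" "b \<in> dring l" "b \<notin> P" "\<And>w. b * \<eta> w - \<omega> w \<in> P"
  shows "spanned \<eta>"
proof -
  obtain a U c where *: "a \<in> dring l" "a \<notin> P" "finite U" "U \<subseteq> L" "\<And>u. c u \<in> dring l"
    "\<And>w. a * \<omega> w - (\<Sum>u\<in>U. c u * pd w (G u)) \<in> P"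
    using assms(1) unfolding spanned_def by blast
  have "(a * b) * \<eta> w - (\<Sum>u\<in>U. c u * pd w (G u)) \<in> P" for w
  proof -
    have "(a * b) * \<eta> w - (\<Sum>u\<in>U. c u * pd w (G u))
        = a * (b * \<eta> w - \<omega> w) + (a * \<omega> w - (\<Sum>u\<in>U. c u * pd w (G u)))"
      by (simp add: algebra_simps)
    then show ?thesis using P_add[OF P_mult[OF assms(4) *(1)] *(6)] by (simp only:)
  qed
  moreover have "a * b \<notin> P" "a * b \<in> dring l" using not_P_mult * assms by auto
  ultimately show ?thesis unfolding spanned_def
    using *(3-5) by (intro exI[of _ "a * b"] exI[of _ U] exI[of _ c]) blast
qed

section \<open>Ritt reduction and its effect on gradients\<close>

definition bad :: "'k dpoly \<Rightarrow> dvar \<Rightarrow> bool" where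
  "bad f v \<longleftrightarrow> v \<in> L \<and> deg_in v (G v) \<le> deg_in v f"

lemma bad_in_dvars: "bad f v \<Longrightarrow> v \<in> dvars f"
  using G_deg[of v] by (auto simp: bad_def deg_in_pos_iff[symmetric])

lemma max_bad:
  assumes "bad f v"
  obtains u where "bad f u" "\<And>w. bad f w \<Longrightarrow> rk w u"
proof -
  have "{v. bad f v} \<subseteq> dvars f" using bad_in_dvars by blast
  then have "finite {v. bad f v}" using finite_dvars finite_subset by blast
  moreover have "{v. bad f v} \<noteq> {}" using assms by blast
  moreover have "{v. bad f v} \<subseteq> V" using L_V unfolding bad_def by blast
  ultimately obtain u where "u \<in> {v. bad f v}" "\<And>w. w \<in> {v. bad f v} \<Longrightarrow> rk w u"
    by (rule finite_has_max) (rule that)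
  then show ?thesis using that by simp
qed

text \<open>Pseudo-division at the highest obstruction to reducedness cancels the top power of v.
  Neither \<open>G v\<close> nor its initial b has variables above v, so degrees there do not grow
  and no obstruction above v arises.\<close>

lemma reduction_step:
  assumes f: "f \<in> P" and v: "bad f v" "\<And>w. bad f w \<Longrightarrow> rk w v"
  obtains b q f' where "b \<in> dring l" "b \<notin> P" "q \<in> dring l" "f' \<in> P" "f' = b * f - q * G v"
    "deg_in v f' < deg_in v f" "\<And>w. bad f' w \<Longrightarrow> rk w v"
proof -
  have vL: "v \<in> L" and le: "deg_in v (G v) \<le> deg_in v f" using v(1) by (auto simp: bad_def)
  have vV: "v \<in> V" using vL L_V by auto
  let ?n = "deg_in v f" and ?m = "deg_in v (G v)"
  have m0: "0 < ?m" using G_deg[OF vL] .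
  obtain b g0 where g: "G v = b * X v ^ ?m + g0" "deg_in v b = 0" "b \<notin> P" "deg_in v g0 < ?m"
      "\<And>w. deg_in w b \<le> deg_in w (G v)" "\<And>w. deg_in w g0 \<le> deg_in w (G v)"
    using pivot_G[OF vL] unfolding pivot_def by blast
  obtain c f0 where c: "f = c * X v ^ ?n + f0" "deg_in v c = 0"
    "\<And>m. m \<in> Poly_Mapping.keys f0 \<Longrightarrow> Poly_Mapping.lookup m v < ?n"
    "\<And>w. deg_in w c \<le> deg_in w f" "\<And>w. deg_in w f0 \<le> deg_in w f"
    using leading_coeff_decomp[of f v] by blast
  have f0: "deg_in v f0 < ?n" using deg_in_less_iff[of ?n v f0] c(3) m0 le by simp
  have sub: "dvars h \<subseteq> dvars h'" if "\<And>w. deg_in w h \<le> deg_in w h'" for h h' :: "'k dpoly"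
    using that by (metis deg_in_pos_iff less_le_trans subsetI)
  have bd: "b \<in> dring l" using sub[OF g(5)] P_dring[OF G_P[OF vL]] by (auto simp: dring_dvars)
  have cd: "c \<in> dring l" using sub[OF c(4)] P_dring[OF f] by (auto simp: dring_dvars)
  define q where "q = c * X v ^ (?n - ?m)"
  have qd: "q \<in> dring l" unfolding q_def using cd vV by (intro dring_mult dring_X_power)
  define f' where "f' = b * f - q * G v"
  have f'P: "f' \<in> P" unfolding f'_def using P_mult bd qd f G_P[OF vL] P_diff by blast
  have "q * (b * X v ^ ?m) = b * (c * X v ^ ?n)"
  proof -
    have "X v ^ (?n - ?m) * X v ^ ?m = (X v ^ ?n :: 'k dpoly)" using le by (simp flip: power_add)
    moreover have "q * (b * X v ^ ?m) = b * (c * (X v ^ (?n - ?m) * X v ^ ?m))"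
      by (simp only: q_def ac_simps)
    ultimately show ?thesis by (simp only:)
  qed
  then have f'0: "f' = b * f0 - q * g0"
    unfolding f'_def by (subst g(1), subst c(1)) (simp only: distrib_left, simp)
  have "deg_in v q \<le> ?n - ?m"
    unfolding q_def using deg_in_mult[of v c "X v ^ (?n - ?m)"] c(2) by (simp add: deg_in_X_power)
  then have "deg_in v (q * g0) < ?n" using deg_in_mult[of v q g0] g(4) le by linarith
  moreover have "deg_in v (b * f0) < ?n" using deg_in_mult[of v b f0] g(2) f0 by linarith
  ultimately have less: "deg_in v f' < ?n" unfolding f'0
    using deg_in_diff[of v "b * f0" "q * g0"] by linarith
  have "rk w v" if w: "bad f' w" for w
  proof (rule ccontr)
    assume "\<not> rk w v"
    have wL: "w \<in> L" "w \<in> V" using w L_V by (auto simp: bad_def)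
    have wv: "w \<noteq> v" using \<open>\<not> rk w v\<close> rk_refl[OF vV] by blast
    have Gw: "deg_in w (G v) = 0" using G_le[OF vL, of w] \<open>\<not> rk w v\<close> by (auto simp: deg_in_0_iff)
    have "deg_in w (b * f) \<le> deg_in w f" using deg_in_mult[of w b f] g(5)[of w] Gw by simp
    moreover have "deg_in w q \<le> deg_in w f"
      unfolding q_def using deg_in_mult[of w c "X v ^ (?n - ?m)"] c(4)[of w] wv
      by (simp add: deg_in_X_power)
    then have "deg_in w (q * G v) \<le> deg_in w f" using deg_in_mult[of w q "G v"] Gw by simp
    ultimately have "deg_in w f' \<le> deg_in w f" unfolding f'_def
      using deg_in_diff[of w "b * f" "q * G v"] by linarith
    then have "bad f w" using w by (auto simp: bad_def)
    then show False using v(2) \<open>\<not> rk w v\<close> by blast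
  qed
  then show ?thesis using that bd g(3) qd f'P f'_def less by blast
qed

text \<open>By the Leibniz rule the gradient of b f - q \<open>G v\<close> differs from b times the
  gradient of f minus q times that of \<open>G v\<close> by multiples of f and \<open>G v\<close>,
  which vanish modulo P.\<close>

lemma spanned_reduction:
  assumes "f \<in> P" "b \<in> dring l" "b \<notin> P" "q \<in> dring l" "f' = b * f - q * G v" "v \<in> L"
    and "spanned (\<lambda>w. pd w f')"
  shows "spanned (\<lambda>w. pd w f)"
proof (rule spanned_cancel[OF spanned_add[OF assms(7) spanned_scale[OF spanned_single[OF assms(6)] assms(4)]]])
  fix w
  have "b * pd w f - (pd w f' + q * pd w (G v)) = pd w q * G v - pd w b * f"
    by (simp add: assms(5) pd_diff pd_mult algebra_simps)
  moreover have "pd w q * G v \<in> P" "pd w b * f \<in> P"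
    using P_mult assms(1,2,4) G_P[OF assms(6)] dring_pd by blast+
  ultimately show "b * pd w f - (pd w f' + q * pd w (G v)) \<in> P" using P_diff by simp
qed (use assms in auto)

lemma spanned_no_bad:
  assumes "f \<in> P" "\<And>v. \<not> bad f v"
  shows "spanned (\<lambda>w. pd w f)"
proof -
  have "deg_in v f < deg_in v (G v)" if "v \<in> L" for v
    using assms(2)[of v] that by (simp add: bad_def)
  then have "f = 0" by (intro no_reduced[OF assms(1)] reduced_if_below_G)
  then show ?thesis using spanned_0 by simp
qed

lemma spanned_grad_bad:
  assumes "f \<in> P" "bad f v" "\<And>w. bad f w \<Longrightarrow> rk w v"
  shows "spanned (\<lambda>w. pd w f)"
proof -
  \<comment> \<open>The measure is the highest obstruction together with the degree in it; degrees
    in lower variables may grow meanwhile.\<close>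
  have wf: "wf (Lt <*lex*> less_than)" by (intro wf_lex_prod wf_Lt wf_less_than)
  have "\<forall>f. f \<in> P \<and> bad f (fst p) \<and> (\<forall>w. bad f w \<longrightarrow> rk w (fst p)) \<and> deg_in (fst p) f = snd p
      \<longrightarrow> spanned (\<lambda>w. pd w f)" for p
  proof (induction p rule: wf_induct_rule[OF wf])
    case (1 p)
    show ?case
    proof (intro allI impI, elim conjE)
      fix f assume f: "f \<in> P" "bad f (fst p)" "\<forall>w. bad f w \<longrightarrow> rk w (fst p)" "deg_in (fst p) f = snd p"
      obtain b q f' where r: "b \<in> dring l" "b \<notin> P" "q \<in> dring l" "f' \<in> P" "f' = b * f - q * G (fst p)"
          "deg_in (fst p) f' < deg_in (fst p) f" "\<And>w. bad f' w \<Longrightarrow> rk w (fst p)"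
        using reduction_step[OF f(1,2)] f(3) by blast
      have "spanned (\<lambda>w. pd w f')"
      proof (cases "\<exists>v. bad f' v")
        case False
        then show ?thesis using spanned_no_bad[OF r(4)] by blast
      next
        case True
        then obtain u where u: "bad f' u" "\<And>w. bad f' w \<Longrightarrow> rk w u" using max_bad by blast
        have V: "u \<in> V" "fst p \<in> V" using u(1) f(2) L_V by (auto simp: bad_def)
        have "((u, deg_in u f'), p) \<in> Lt <*lex*> less_than"
          using r(7)[OF u(1)] r(6) f(4) V by (cases p) (auto simp: Lt_def lt_def)
        from "1.IH"[OF this] show ?thesis using r(4) u by simp
      qed
      then show "spanned (\<lambda>w. pd w f)"
        using spanned_reduction[OF f(1) r(1,2,3,5)] f(2) by (simp add: bad_def)
    qed
  qed
  from this[of "(v, deg_in v f)"] show ?thesis using assms by simp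
qed

lemma spanned_grad: "f \<in> P \<Longrightarrow> spanned (\<lambda>w. pd w f)"
proof (cases "\<exists>v. bad f v")
  case True
  then obtain v where "bad f v" "\<And>w. bad f w \<Longrightarrow> rk w v" using max_bad by blast
  moreover assume "f \<in> P"
  ultimately show ?thesis using spanned_grad_bad by blast
qed (use spanned_no_bad in blast)

lemma spanned_N: "\<omega> \<in> N \<Longrightarrow> spanned \<omega>"
  by (induction rule: N.induct) (simp_all add: spanned_grad spanned_add spanned_scale)

text \<open>The pivot gradients are triangular: at the highest u whose coefficient lies outside P,
  pivots with lower leaders contribute nothing and \<open>G u\<close> contributes its
  separant.\<close>

lemma N_meets_L:
  assumes "\<omega> \<in> N" "\<omega> v \<notin> P"
  obtains u where "u \<in> L" "\<omega> u \<notin> P"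
proof -
  obtain a U c where *: "a \<in> dring l" "a \<notin> P" "finite U" "U \<subseteq> L" "\<And>u. c u \<in> dring l"
    "\<And>w. a * \<omega> w - (\<Sum>u\<in>U. c u * pd w (G u)) \<in> P"
    using spanned_N[OF assms(1)] unfolding spanned_def by blast
  have Gd: "pd w (G u) \<in> dring l" if "u \<in> U" for u w
    using P_dring[OF G_P, of u] that *(4) by auto
  define U1 where "U1 = {u\<in>U. c u \<notin> P}"
  have aw: "a * \<omega> w \<in> P \<longleftrightarrow> (\<Sum>u\<in>U. c u * pd w (G u)) \<in> P" for w by (rule P_diff_iff[OF *(6)])
  have "U1 \<noteq> {}"
  proof
    assume "U1 = {}"
    then have "c u \<in> P" if "u \<in> U" for u using that unfolding U1_def by blast
    then have "(\<Sum>u\<in>U. c u * pd v (G u)) \<in> P" by (intro P_sum P_mult_right Gd)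
    then show False using aw[of v] not_P_mult[OF *(1) N_dring[OF assms(1)] *(2) assms(2)] by blast
  qed
  moreover have U1: "finite U1" "U1 \<subseteq> V" using *(3,4) L_V by (auto simp: U1_def)
  ultimately obtain u where u: "u \<in> U1" "\<And>w. w \<in> U1 \<Longrightarrow> rk w u"
    using finite_has_max[of U1] by metis
  have uU: "u \<in> U" "u \<in> L" using u *(4) by (auto simp: U1_def)
  have "c x * pd u (G x) \<in> P" if x: "x \<in> U" "x \<noteq> u" for x
  proof (cases "x \<in> U1")
    case True
    have "u \<notin> dvars (G x)"
    proof
      assume "u \<in> dvars (G x)"
      then have "rk u x" using G_le[of x u] x *(4) by blast
      then show False using rk_antisym[of u x] u(1) u(2)[OF True] True U1(2) x(2) by blast
    qed
    then show ?thesis by (simp add: in_dvars_iff_pd)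
  next
    case False
    then have "c x \<in> P" using x unfolding U1_def by blast
    then show ?thesis using Gd[OF x(1)] by (rule P_mult_right)
  qed
  then have "(\<Sum>x\<in>U - {u}. c x * pd u (G x)) \<in> P" by (intro P_sum) blast
  moreover have "(\<Sum>x\<in>U. c x * pd u (G x)) = c u * pd u (G u) + (\<Sum>x\<in>U - {u}. c x * pd u (G x))"
    using *(3) uU by (simp add: sum.remove)
  moreover have "c u * pd u (G u) \<notin> P"
    using not_P_mult[OF *(5) Gd[OF uU(1)]] u G_pd[OF uU(2)] by (auto simp: U1_def)
  ultimately have "(\<Sum>x\<in>U. c x * pd u (G x)) \<notin> P"
    using P_diff_iff[of "\<Sum>x\<in>U. c x * pd u (G x)" "c u * pd u (G u)"] by simp
  then have "a * \<omega> u \<notin> P" using aw by blast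
  then have "\<omega> u \<notin> P" using P_mult[of "\<omega> u" a] *(1) by blast
  then show ?thesis using that uU by blast
qed

section \<open>The derivatives outside L as a basis\<close>

definition B :: "dvar set" where "B = V - L"

lemma B_indep: "indep B"
  unfolding indep_def
proof (intro ballI notI)
  fix v assume v: "v \<in> B" "dep v (B - {v})"
  have "v \<notin> B - {v}" by simp
  with v(2) obtain \<omega> where \<omega>: "\<omega> \<in> N" "\<omega> v \<notin> P" "\<And>w. w \<noteq> v \<Longrightarrow> w \<notin> B - {v} \<Longrightarrow> \<omega> w \<in> P"
    by (rule depE) (rule that)
  obtain u where u: "u \<in> L" "\<omega> u \<notin> P" using N_meets_L[OF \<omega>(1,2)] .
  have "u \<notin> B" using u by (simp add: B_def)
  then show False using \<omega>(3)[of u] u v by auto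
qed

lemma L_dep_lower: "u \<in> L \<Longrightarrow> dep u {w \<in> V. lt w u}"
proof (rule depI[OF grad])
  assume u: "u \<in> L"
  show "G u \<in> P" "pd u (G u) \<notin> P" using G_P G_pd u by auto
  fix w assume w: "w \<noteq> u" "w \<notin> {w \<in> V. lt w u}"
  have "w \<notin> dvars (G u)"
  proof
    assume wG: "w \<in> dvars (G u)"
    then have "w \<in> V" "rk w u" using G_le[OF u wG] P_dring[OF G_P[OF u]] by (auto simp: dring_dvars)
    then show False using w by (simp add: lt_def)
  qed
  then show "pd w (G u) \<in> P" by (simp add: in_dvars_iff_pd)
qed

text \<open>Replacing elements of L by lower derivatives terminates because the ranking is
  well-founded. The bound by v is kept because for an orderly ranking it limits orders
  (\<open>V_dep_trunc_orderly\<close>).\<close>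

lemma V_dep_B: "v \<in> V \<Longrightarrow> dep v {w \<in> B. rk w v}"
proof (induction v rule: wf_induct_rule[OF wf_Lt])
  case (1 v)
  show ?case
  proof (cases "v \<in> L")
    case False
    then show ?thesis using 1 rk_refl by (intro dep_mem) (simp add: B_def)
  next
    case True
    show ?thesis
    proof (rule dep_trans[OF L_dep_lower[OF True]])
      fix s assume s: "s \<in> {w \<in> V. lt w v}"
      then have "dep s {w \<in> B. rk w s}" using 1 by (auto simp: Lt_def)
      moreover have "{w \<in> B. rk w s} \<subseteq> {w \<in> B. rk w v}"
        using s 1(2) rk_trans[of _ s v] by (auto simp: B_def lt_def)
      ultimately show "dep s {w \<in> B. rk w v}" by (rule dep_mono)
    qed
  qed
qed

end

section \<open>Counting\<close>

text \<open>The shape of the basis: an indeterminate with a leader of order \<rho> j contributes a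
  finite column, one without a leader an infinite column.\<close>

definition stairs :: "nat \<Rightarrow> nat set \<Rightarrow> (nat \<Rightarrow> nat) \<Rightarrow> dvar set" where
  "stairs l J \<rho> = {(j, r). j < l \<and> (j \<in> J \<longrightarrow> r < \<rho> j)}"

definition trunc :: "dvar set \<Rightarrow> nat \<Rightarrow> dvar set" where
  "trunc S s = {w \<in> S. snd w \<le> s}"

lemma trunc_mono: "s \<le> t \<Longrightarrow> trunc S s \<subseteq> trunc S t"
  by (auto simp: trunc_def)

lemma trunc_subset: "trunc S s \<subseteq> S"
  by (auto simp: trunc_def)

lemma trunc_stairs:
  "trunc (stairs l J \<rho>) s = (SIGMA j:{..<l}. if j \<in> J then {..<min (\<rho> j) (Suc s)} else {..<Suc s})"
  by (auto simp: trunc_def stairs_def split: if_splits)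

lemma finite_trunc_stairs [simp]: "finite (trunc (stairs l J \<rho>) s)"
  unfolding trunc_stairs by auto

lemma card_trunc_stairs:
  assumes "J \<subseteq> {..<l}"
  shows "card (trunc (stairs l J \<rho>) s) = (l - card J) * Suc s + (\<Sum>j\<in>J. min (\<rho> j) (Suc s))"
proof -
  have "card (trunc (stairs l J \<rho>) s) = (\<Sum>j<l. if j \<in> J then min (\<rho> j) (Suc s) else Suc s)"
    unfolding trunc_stairs by (subst card_SigmaI) (auto intro!: sum.cong)
  also have "\<dots> = (\<Sum>j\<in>J. min (\<rho> j) (Suc s)) + (\<Sum>j\<in>{..<l} - J. Suc s)"
    using assms by (subst sum.subset_diff[of J "{..<l}"]) (auto simp: add.commute)
  finally show ?thesis using assms card_Diff_subset[of J "{..<l}"] finite_subset[OF assms] by simp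
qed

context prime_dideal
begin

text \<open>A relation has only finitely many coefficients outside P.\<close>

lemma dep_trunc:
  assumes "dep v S"
  shows "\<exists>s. dep v (trunc S s)"
proof (cases "v \<in> S")
  case True
  then show ?thesis by (intro exI[of _ "snd v"] dep_mem) (simp add: trunc_def)
next
  case False
  with assms obtain \<omega> where \<omega>: "\<omega> \<in> N" "\<omega> v \<notin> P" "\<And>w. w \<noteq> v \<Longrightarrow> w \<notin> S \<Longrightarrow> \<omega> w \<in> P"
    by (rule depE) (rule that)
  define s where "s = Max (snd ` {w. \<omega> w \<notin> P})"
  have "snd w \<le> s" if "\<omega> w \<notin> P" for w
    unfolding s_def using N_finite_support[OF \<omega>(1)] that by (intro Max_ge) simp_all
  then have "\<omega> w \<in> P" if "w \<noteq> v" "w \<notin> trunc S s" for w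
    using \<omega>(3)[of w] that unfolding trunc_def by blast
  then show ?thesis using depI[OF \<omega>(1,2)] by blast
qed

lemma indep_not_dep: "indep I \<Longrightarrow> v \<in> I \<Longrightarrow> S \<subseteq> I - {v} \<Longrightarrow> \<not> dep v S"
  using dep_mono unfolding indep_def by blast

end

text \<open>B0 models the basis from an orderly ranking, B the one from the given ranking. B0 spans
  every v without raising the order; for B no such bound is assumed, and the purpose of the locale
  is to obtain one.\<close>

locale two_bases = prime_dideal \<delta> l P for \<delta> :: "'k::field_char_0 \<Rightarrow> 'k" and l P +
  fixes J0 J :: "nat set" and \<rho>0 \<rho> :: "nat \<Rightarrow> nat" and h :: nat
  assumes J0: "J0 \<subseteq> {..<l}" and J: "J \<subseteq> {..<l}"
    and indep0: "indep (stairs l J0 \<rho>0)" and indep: "indep (stairs l J \<rho>)"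
    and spans0: "v \<in> dvars_of l \<Longrightarrow> dep v (trunc (stairs l J0 \<rho>0) (snd v))"
    and spans: "v \<in> dvars_of l \<Longrightarrow> dep v (stairs l J \<rho>)"
    and h: "h = (\<Sum>j\<in>J0. \<rho>0 j)"
begin

abbreviation B0 :: "dvar set" where "B0 \<equiv> stairs l J0 \<rho>0"
abbreviation B :: "dvar set" where "B \<equiv> stairs l J \<rho>"

lemma finite_J: "finite J"
  using J finite_subset by blast

lemma B_V: "B \<subseteq> dvars_of l" and B0_V: "B0 \<subseteq> dvars_of l"
  by (auto simp: stairs_def dvars_of_def)

lemma spans0_trunc: "v \<in> dvars_of l \<Longrightarrow> snd v \<le> s \<Longrightarrow> dep v (trunc B0 s)"
  using spans0 dep_mono trunc_mono by blast

lemma corner_V: "j \<in> J \<Longrightarrow> (j, r) \<in> dvars_of l"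
  using J by (auto simp: dvars_of_def)

text \<open>The corners (j, \<rho> j), just above the finite columns, are the leaders; e bounds the
  orders used to express them.\<close>

definition bounded_by :: "nat \<Rightarrow> bool" where
  "bounded_by e \<longleftrightarrow> (\<forall>j\<in>J. dep (j, \<rho> j) (trunc B e))"

lemma bounded_by_exists: "\<exists>e. bounded_by e"
proof -
  have "\<exists>e. dep (j, \<rho> j) (trunc B e)" if "j \<in> J" for j
    using dep_trunc spans corner_V[OF that] by blast
  then obtain e where e: "\<And>j. j \<in> J \<Longrightarrow> dep (j, \<rho> j) (trunc B (e j))" by metis
  have "dep (j, \<rho> j) (trunc B (\<Sum>j\<in>J. e j))" if "j \<in> J" for j
    using e[OF that] by (rule dep_mono) (intro trunc_mono member_le_sum that finite_J, simp)
  then show ?thesis unfolding bounded_by_def by blast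
qed

text \<open>A shift leaves B only from the top of a finite column, and then it lands on a
  corner.\<close>

lemma dshift_B:
  assumes "bounded_by e" "e \<le> s'" "s < s'" "w \<in> trunc B s"
  shows "dep (dshift w) (trunc B s')"
proof (cases "dshift w \<in> B")
  case True
  then show ?thesis using assms by (intro dep_mem) (simp add: trunc_def dshift_def)
next
  case False
  obtain j r where w: "w = (j, r)" by (cases w)
  have "j \<in> J" "Suc r = \<rho> j" using False assms(4) by (auto simp: w trunc_def stairs_def dshift_def)
  then have "dep (dshift w) (trunc B e)" using assms(1) by (auto simp: bounded_by_def w dshift_def)
  then show ?thesis by (rule dep_mono) (intro trunc_mono assms)
qed

lemma dshift_dep:
  assumes "bounded_by e" "e \<le> s" "dep v (trunc B s)"
  shows "dep (dshift v) (trunc B (Suc s))"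
proof (rule dep_trans[OF dep_dshift[OF assms(3)]])
  have up: "trunc B s \<subseteq> trunc B (Suc s)" by (rule trunc_mono) simp
  fix w assume "w \<in> insert v (trunc B s \<union> dshift ` trunc B s)"
  then consider "w = v" | "w \<in> trunc B s" | w' where "w' \<in> trunc B s" "w = dshift w'" by blast
  then show "dep w (trunc B (Suc s))"
  proof cases
    case 1
    then show ?thesis using assms(3) dep_mono up by blast
  next
    case 2
    then show ?thesis using dep_mem up by blast
  next
    case 3
    then show ?thesis using dshift_B[OF assms(1), of "Suc s" s w'] assms(2) by simp
  qed
qed

lemma dep_corner_derivative:
  assumes "bounded_by e" "j \<in> J"
  shows "dep (j, \<rho> j + i) (trunc B (e + i))"
proof (induction i)
  case 0
  then show ?case using assms by (simp add: bounded_by_def)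
next
  case (Suc i)
  then show ?case using dshift_dep[OF assms(1) _ Suc] by (simp add: dshift_def)
qed

lemma dep_trunc_shift:
  assumes "bounded_by e" "v \<in> dvars_of l" "snd v \<le> s"
  shows "dep v (trunc B (e + s))"
proof -
  obtain j r where v: "v = (j, r)" by (cases v)
  show ?thesis
  proof (cases "v \<in> B")
    case True
    then show ?thesis using assms(3) by (intro dep_mem) (simp add: trunc_def)
  next
    case False
    then have "j \<in> J" "\<rho> j \<le> r" using assms(2) by (auto simp: v stairs_def dvars_of_def)
    then have "dep v (trunc B (e + (r - \<rho> j)))"
      using dep_corner_derivative[OF assms(1), of j "r - \<rho> j"] by (simp add: v)
    then show ?thesis by (rule dep_mono) (use assms(3) v in \<open>intro trunc_mono, simp\<close>)
  qed
qed

section \<open>Comparing the cardinalities of the two bases\<close>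

lemma card_B_le_B0: "card (trunc B s) \<le> card (trunc B0 s)"
proof (rule indep_card_le)
  show "indep (trunc B s)" using indep indep_subset trunc_subset by blast
  show "dep v (trunc B0 s)" if "v \<in> trunc B s" for v
    using that B_V by (intro spans0_trunc) (auto simp: trunc_def)
qed simp_all

lemma card_B0_le_B: "bounded_by e \<Longrightarrow> card (trunc B0 s) \<le> card (trunc B (e + s))"
proof (rule indep_card_le)
  assume e: "bounded_by e"
  show "indep (trunc B0 s)" using indep0 indep_subset trunc_subset by blast
  show "dep v (trunc B (e + s))" if "v \<in> trunc B0 s" for v
    using that B0_V by (intro dep_trunc_shift[OF e]) (auto simp: trunc_def)
qed simp_all

text \<open>Both counts grow linearly, with the numbers of infinite columns as slopes, and the
  constant shift e cannot make up for a larger slope of B0.\<close>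

lemma diff_dim_le: "l - card J0 \<le> l - card J"
proof (rule ccontr)
  define m where "m = l - card J"
  assume "\<not> l - card J0 \<le> l - card J"
  then have m: "Suc m \<le> l - card J0" by (simp add: m_def)
  obtain e where e: "bounded_by e" using bounded_by_exists by blast
  \<comment> \<open>A slope of at least m + 1 would give (m + 1)(s + 1) \<le> m (e + s + 1) + (sum
    of the \<rho> j), which for this s reads s + 1 \<le> s.\<close>
  define s where "s = m * e + (\<Sum>j\<in>J. \<rho> j)"
  have "Suc m * Suc s \<le> (l - card J0) * Suc s" using m by (rule mult_le_mono1)
  also have "\<dots> \<le> card (trunc B0 s)" by (simp add: card_trunc_stairs[OF J0])
  also have "\<dots> \<le> card (trunc B (e + s))" by (rule card_B0_le_B[OF e])
  also have "\<dots> \<le> m * Suc (e + s) + (\<Sum>j\<in>J. \<rho> j)"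
    unfolding card_trunc_stairs[OF J] m_def by (intro add_left_mono sum_mono) simp
  finally show False by (simp add: s_def algebra_simps)
qed

lemma card_B0_le: "card (trunc B0 s) \<le> (l - card J) * Suc s + h"
proof -
  have "card (trunc B0 s) \<le> (l - card J0) * Suc s + h"
    unfolding card_trunc_stairs[OF J0] h by (intro add_left_mono sum_mono) simp
  then show ?thesis using mult_le_mono1[OF diff_dim_le, of "Suc s"] by linarith
qed

lemma card_B:
  assumes "\<And>j. j \<in> J \<Longrightarrow> \<rho> j \<le> s"
  shows "card (trunc B s) = (l - card J) * Suc s + (\<Sum>j\<in>J. \<rho> j)"
proof -
  have "(\<Sum>j\<in>J. min (\<rho> j) (Suc s)) = (\<Sum>j\<in>J. \<rho> j)"
    using assms by (intro sum.cong refl min_absorb1) fastforce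
  then show ?thesis unfolding card_trunc_stairs[OF J] by simp
qed

lemma rho_le_sum: "j \<in> J \<Longrightarrow> \<rho> j \<le> (\<Sum>j\<in>J. \<rho> j)"
  by (rule member_le_sum) (simp_all add: finite_J)

text \<open>At an order where all finite columns are complete, the count of B is its linear part
  plus the sum of the \<rho> j, while that of B0 exceeds the same linear part by at most h.\<close>

lemma sum_rho_le: "(\<Sum>j\<in>J. \<rho> j) \<le> h"
  using card_B[of "\<Sum>j\<in>J. \<rho> j"] rho_le_sum card_B_le_B0[of "\<Sum>j\<in>J. \<rho> j"]
    card_B0_le[of "\<Sum>j\<in>J. \<rho> j"] by simp

lemma rho_le: "j \<in> J \<Longrightarrow> \<rho> j \<le> h"
  using rho_le_sum sum_rho_le le_trans by blast

text \<open>If the relation expressing a corner by B has order e above h, differentiating it turns the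
  derivatives of the corner into independent elements in addition to B, which exceeds the bound on
  the number of independent derivatives of order at most e.\<close>

lemma bounded_by_h: "bounded_by h"
proof -
  define e where "e = (LEAST e. bounded_by e)"
  have be: "bounded_by e" unfolding e_def using bounded_by_exists by (rule LeastI_ex)
  have "e \<le> h"
  proof (rule ccontr)
    assume "\<not> e \<le> h"
    then have he: "h < e" by simp
    \<comment> \<open>Since e > h is positive, e - 1 is a smaller candidate and fails: some corner
      really needs order e.\<close>
    then have "\<not> bounded_by (e - 1)" unfolding e_def by (intro not_less_Least) simp
    then obtain j0 where j0: "j0 \<in> J" "\<not> dep (j0, \<rho> j0) (trunc B (e - 1))" unfolding bounded_by_def by blast
    define u where "u i = (j0, \<rho> j0 + i)" for i
    have u0: "u 0 = (j0, \<rho> j0)" by (simp add: u_def)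
    have uB: "u i \<notin> B" for i using j0 by (simp add: u_def stairs_def)
    have rj0: "\<rho> j0 < e" using rho_le[OF j0(1)] he by simp
    have "u 0 \<notin> trunc B e" using uB trunc_subset by blast
    moreover have "dep (u 0) (trunc B e)" using be j0(1) by (simp add: bounded_by_def u0)
    ultimately obtain \<omega> where \<omega>: "\<omega> \<in> N" "\<omega> (u 0) \<notin> P"
        "\<And>w. w \<noteq> u 0 \<Longrightarrow> w \<notin> trunc B e \<Longrightarrow> \<omega> w \<in> P"
      using depE[of "u 0" "trunc B e" thesis] by blast
    have "\<exists>w. w \<noteq> u 0 \<and> w \<notin> trunc B (e - 1) \<and> \<omega> w \<notin> P"
      using j0(2) depI[OF \<omega>(1,2), of "trunc B (e - 1)"] unfolding u0 by blast
    then obtain w where w: "w \<noteq> u 0" "w \<notin> trunc B (e - 1)" "\<omega> w \<notin> P" by blast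
    have wB: "w \<in> trunc B e" using \<omega>(3)[of w] w by blast
    then have "snd w = e" using w(2) by (auto simp: trunc_def)
    then obtain t where t: "w = (t, e)" by (cases w) simp
    \<comment> \<open>Finite columns have height at most h < e, so the element of order e lies in an
      infinite column, whose further elements all stay in B.\<close>
    have tJ: "t \<notin> J"
    proof
      assume "t \<in> J"
      then show False using wB rho_le[of t] he by (simp add: t trunc_def stairs_def)
    qed
    have tl: "t < l" using wB by (simp add: t trunc_def stairs_def)
    define top where "top i = {(x, e + i) | x. x < l \<and> x \<notin> J}" for i
    have topB: "top i \<subseteq> trunc B (e + i)" for i by (auto simp: top_def trunc_def stairs_def)
    have dtop: "dshift v \<in> top (Suc i)" if "v \<in> top i" for v i
      using that by (auto simp: top_def dshift_def)
    have du: "dshift (u i) = u (Suc i)" for i by (simp add: u_def dshift_def)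
    have dep_u: "dep (u i) (trunc B (e + i))" for i
      unfolding u_def by (rule dep_corner_derivative[OF be j0(1)])
    \<comment> \<open>Spanned below order e + i, and by order e + i after one more shift. At i = 0
      the second part comes from \<open>dshift_B\<close>, as \<open>dshift_dep\<close> would require
      order at least e; for larger i it follows from the first.\<close>
    define low where "low i v \<longleftrightarrow> dep v (trunc B (e + i - 1)) \<and> dep (dshift v) (trunc B (e + i))" for i v
    have supp: "v = u i \<or> v \<in> top i \<or> low i v" if "(D ^^ i) \<omega> v \<notin> P" for i v
      using that
    proof (induction i arbitrary: v)
      case 0
      show ?case
      proof (cases "v = u 0")
        case False
        then have v: "v \<in> trunc B e" using 0 \<omega>(3)[of v] by auto
        show ?thesis
        proof (cases "snd v = e")
          case True
          have "fst v \<notin> J" using v True rho_le[of "fst v"] he by (auto simp: trunc_def stairs_def)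
          then have "v \<in> top 0" using v True
            by (cases v) (auto simp: top_def trunc_def stairs_def)
          then show ?thesis by blast
        next
          case False
          then have v1: "v \<in> trunc B (e - 1)" using v by (auto simp: trunc_def)
          then have "low 0 v" unfolding low_def
            using dshift_B[OF be _ _ v1, of e] dep_mem he by simp
          then show ?thesis by blast
        qed
      qed simp
    next
      case (Suc i)
      have lowI: "low (Suc i) v" if "dep v (trunc B (e + i))" for v
        unfolding low_def using that dshift_dep[OF be _ that] by simp
      \<comment> \<open>One step later the whole old support is low, including u i and
        \<open>top i\<close>; the new front consists of their shifts.\<close>
      have same: "low (Suc i) v" if "v = u i \<or> v \<in> top i \<or> low i v" for v
      proof (rule lowI)
        have "trunc B (e + i - 1) \<subseteq> trunc B (e + i)" by (rule trunc_mono) simp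
        then show "dep v (trunc B (e + i))"
          using that dep_u topB[of i] dep_mem dep_mono unfolding low_def by blast
      qed
      have next_: "dshift v = u (Suc i) \<or> dshift v \<in> top (Suc i) \<or> low (Suc i) (dshift v)"
        if "v = u i \<or> v \<in> top i \<or> low i v" for v
        using that lowI[of "dshift v"] du dtop unfolding low_def by blast
      have "D ((D ^^ i) \<omega>) v \<notin> P" using Suc.prems by simp
      then consider "(D ^^ i) \<omega> v \<notin> P" | v' where "v = dshift v'" "(D ^^ i) \<omega> v' \<notin> P"
        using D_support by blast
      then show ?case
      proof cases
        case 1
        then show ?thesis using same Suc.IH by blast
      next
        case 2
        then show ?thesis using next_ Suc.IH by blast
      qed
    qed
    have tB: "(t, r) \<in> B" for r using tl tJ by (simp add: stairs_def)
    have nz: "(D ^^ i) \<omega> (t, e + i) \<notin> P" for i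
    proof (induction i)
      case 0
      then show ?case using w by (simp add: t)
    next
      case (Suc i)
      \<comment> \<open>This position is not yet reached: it is not u i, its order is not e + i, and
        being low would contradict the independence of B. So \<open>D_dshift\<close> passes the
        coefficient on.\<close>
      have "(D ^^ i) \<omega> (dshift (t, e + i)) \<in> P"
      proof (rule ccontr)
        assume "(D ^^ i) \<omega> (dshift (t, e + i)) \<notin> P"
        then consider "dshift (t, e + i) = u i" | "dshift (t, e + i) \<in> top i" | "low i (dshift (t, e + i))"
          using supp by blast
        then show False
        proof cases
          case 1
          then show ?thesis using tJ j0 by (simp add: dshift_def u_def)
        next
          case 2
          then show ?thesis by (simp add: dshift_def top_def)
        next
          case 3
          then have "dep (t, Suc (e + i)) (trunc B (e + i - 1))" by (simp add: low_def dshift_def)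
          moreover have "trunc B (e + i - 1) \<subseteq> B - {(t, Suc (e + i))}" by (auto simp: trunc_def)
          ultimately show ?thesis using indep_not_dep[OF indep tB] by blast
        qed
      qed
      then show ?case using D_dshift[of "(D ^^ i) \<omega>" "(t, e + i)"] Suc by (simp add: dshift_def)
    qed
    have ND: "(D ^^ i) \<omega> \<in> N" for i by (induction i) (use \<omega>(1) N_D in simp_all)
    \<comment> \<open>The i-th derivative of the relation, solved for (t, e + i) instead of for the
      derivative u i of the corner.\<close>
    have exch: "dep (t, e + i) (insert (u i) (trunc B (e + i) - {(t, e + i)}))" for i
    proof (rule dep_eliminate[OF ND _ nz])
      have "(t, e + i) \<noteq> u i" using tJ j0(1) by (auto simp: u_def)
      then show "(t, e + i) \<notin> insert (u i) (trunc B (e + i) - {(t, e + i)})" by simp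
      fix w assume w: "w \<noteq> (t, e + i)" "(D ^^ i) \<omega> w \<notin> P"
      consider "w = u i" | "w \<in> top i" | "low i w" using supp w(2) by blast
      then show "dep w (insert (u i) (trunc B (e + i) - {(t, e + i)}))"
      proof cases
        case 1
        then show ?thesis by (simp add: dep_mem)
      next
        case 2
        then show ?thesis using topB[of i] w(1) by (intro dep_mem) blast
      next
        case 3
        then have "dep w (trunc B (e + i - 1))" by (simp add: low_def)
        then show ?thesis
        proof (rule dep_mono)
          have "e + i - 1 < e + i" using he by simp
          then show "trunc B (e + i - 1) \<subseteq> insert (u i) (trunc B (e + i) - {(t, e + i)})"
            by (auto simp: trunc_def)
        qed
      qed
    qed
    \<comment> \<open>Exactly for i \<le> k does u i have order at most e, which puts it into the
      span of \<open>trunc B0 e\<close>.\<close>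
    define k where "k = e - \<rho> j0"
    define T where "T = trunc B (e + k)"
    define Q where "Q = Pair t ` {e<..e + k}"
    \<comment> \<open>In T, both the part of order at most e and the k elements of Q are replaced by
      \<open>trunc B0 e\<close>. The result still spans the independent set T, so the replacement is
      at least as large as what it replaces.\<close>
    define T' where "T' = T - (trunc B e \<union> Q) \<union> trunc B0 e"
    have fT: "finite T" "finite T'" by (simp_all add: T_def T'_def)
    have fU: "finite (trunc B e \<union> Q)" by (simp add: Q_def)
    have UT: "trunc B e \<union> Q \<subseteq> T"
      using tB trunc_mono[of e "e + k" B] by (auto simp: Q_def T_def trunc_def)
    have "card (trunc B e \<union> Q) = card (trunc B e) + card Q"
      using fU by (intro card_Un_disjoint) (auto simp: Q_def trunc_def)
    then have cU: "card (trunc B e \<union> Q) = card (trunc B e) + k" by (simp add: Q_def card_image inj_on_def)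
    have depQ: "dep (t, e + i) T'" if "i \<le> k" for i
      using that
    proof (induction i rule: less_induct)
      case (less i)
      show ?case
      proof (cases "i = 0")
        case True
        then show ?thesis using tl
          by (intro dep_mono[OF spans0_trunc[of _ e]]) (auto simp: T'_def dvars_of_def)
      next
        case False
        \<comment> \<open>In the exchange relation, elements of order at most e, among them u i, are
          spanned by \<open>trunc B0 e\<close>; higher ones in column t come by induction, and all
          others are still in T'.\<close>
        show ?thesis
        proof (rule dep_trans[OF exch])
          fix s assume s: "s \<in> insert (u i) (trunc B (e + i) - {(t, e + i)})"
          show "dep s T'"
          proof (cases "s \<in> dvars_of l \<and> snd s \<le> e")
            case True
            then show ?thesis by (intro dep_mono[OF spans0_trunc[of _ e]]) (auto simp: T'_def)
          next
            case False
            have "u i \<in> dvars_of l" "snd (u i) \<le> e"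
              using corner_V[OF j0(1)] less.prems rj0 by (simp_all add: u_def k_def)
            then have s': "s \<in> trunc B (e + i)" "s \<noteq> (t, e + i)" using s False by auto
            then have es: "e < snd s" "snd s \<le> e + i" using False B_V by (auto simp: trunc_def)
            show ?thesis
            proof (cases "fst s = t")
              case True
              then have seq: "s = (t, e + (snd s - e))" using es by (simp add: prod_eq_iff)
              then have "snd s - e < i" using s'(2) es by (cases "snd s = e + i") auto
              then show ?thesis using less.IH[of "snd s - e"] less.prems seq by simp
            next
              case False
              then have "s \<notin> Q" "s \<notin> trunc B e" using es by (auto simp: Q_def trunc_def)
              moreover have "s \<in> T" using s'(1) less.prems trunc_mono[of "e + i" "e + k" B] by (auto simp: T_def)
              ultimately show ?thesis by (intro dep_mem) (simp add: T'_def)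
            qed
          qed
        qed
      qed
    qed
    have "card T \<le> card T'"
    proof (rule indep_card_le[OF _ fT])
      show "indep T" using indep indep_subset trunc_subset by (simp add: T_def)
      fix v assume v: "v \<in> T"
      consider "v \<in> Q" | "v \<in> trunc B e" | "v \<notin> Q" "v \<notin> trunc B e" by blast
      then show "dep v T'"
      proof cases
        case 1
        then obtain q where q: "v = (t, q)" "e < q" "q \<le> e + k" by (auto simp: Q_def)
        then show ?thesis using depQ[of "q - e"] by simp
      next
        case 2
        then show ?thesis using B_V
          by (intro dep_mono[OF spans0_trunc[of v e]]) (auto simp: T'_def trunc_def)
      next
        case 3
        then show ?thesis using v by (intro dep_mem) (simp add: T'_def)
      qed
    qed
    also have "\<dots> \<le> card (T - (trunc B e \<union> Q)) + card (trunc B0 e)"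
      unfolding T'_def by (rule card_Un_le)
    also have "card (T - (trunc B e \<union> Q)) = card T - (card (trunc B e) + k)"
      using card_Diff_subset[OF fU UT] cU by simp
    finally have "card T \<le> card T - (card (trunc B e) + k) + card (trunc B0 e)" .
    moreover have "card (trunc B e) + k \<le> card T"
      using card_mono[OF fT(1) UT] cU by simp
    ultimately have "card (trunc B e) + k \<le> card (trunc B0 e)" by linarith
    also have "\<dots> \<le> (l - card J) * Suc e + h" by (rule card_B0_le)
    finally have "card (trunc B e) + k \<le> (l - card J) * Suc e + h" .
    moreover have "\<rho> j \<le> e" if "j \<in> J" for j using rho_le[OF that] he by simp
    then have "card (trunc B e) = (l - card J) * Suc e + (\<Sum>j\<in>J. \<rho> j)" by (rule card_B)
    ultimately have "(\<Sum>j\<in>J. \<rho> j) + k \<le> h" by linarith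
    \<comment> \<open>As k = e - \<rho> j0 and \<rho> j0 is one of the summands, the sum plus k is
      at least e.\<close>
    then show False using rho_le_sum[OF j0(1)] rj0 he by (simp add: k_def)
  qed
  have "dep (j, \<rho> j) (trunc B h)" if "j \<in> J" for j
    using be that trunc_mono[OF \<open>e \<le> h\<close>] dep_mono unfolding bounded_by_def by blast
  then show ?thesis unfolding bounded_by_def by blast
qed

end

section \<open>Eliminating derivatives of high order\<close>

context charset
begin

definition J :: "nat set" where "J = (\<lambda>f. fst (le f)) ` set C"

text \<open>The order of the leader in column j; distinct members lead distinct columns, so the
  inverse finds the right member.\<close>

definition \<rho> :: "nat \<Rightarrow> nat" where
  "\<rho> j = snd (le (inv_into (set C) (\<lambda>f. fst (le f)) j))"

lemma fst_le_inj: "inj_on (\<lambda>f. fst (le f)) (set C)"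
  using C_fst_inj by (auto simp: inj_on_def)

lemma rho_fst_le: "f \<in> set C \<Longrightarrow> \<rho> (fst (le f)) = snd (le f)"
  unfolding \<rho>_def by (simp add: inv_into_f_f[OF fst_le_inj])

lemma J_subset: "J \<subseteq> {..<l}"
  using C_le_V by (auto simp: J_def dvars_of_def)

lemma B_eq_stairs: "B = stairs l J \<rho>"
proof -
  have "(j, r) \<in> L \<longleftrightarrow> j \<in> J \<and> \<rho> j \<le> r" for j r
    using rho_fst_le by (auto simp: L_def J_def)
  then show ?thesis by (auto simp: B_def stairs_def dvars_of_def not_le)
qed

text \<open>A proper derivative of the leader of g ranks above everything in g, and reducedness
  keeps it out of the other members. So within L only leaders can occur.\<close>

lemma C_dvars: "f \<in> set C \<Longrightarrow> dvars f \<subseteq> B \<union> le ` set C"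
proof
  fix w assume f: "f \<in> set C" and w: "w \<in> dvars f"
  have wV: "w \<in> V" using C_dring[OF f] w by (auto simp: dring_dvars)
  show "w \<in> B \<union> le ` set C"
  proof (cases "w \<in> L")
    case False
    then show ?thesis using wV by (simp add: B_def)
  next
    case True
    then obtain g where g: "g \<in> set C" "fst w = fst (le g)" "snd (le g) \<le> snd w" by (auto simp: L_def)
    have "snd (le g) = snd w"
    proof (rule ccontr)
      assume ne: "snd (le g) \<noteq> snd w"
      define s where "s = snd w - snd (le g)"
      have s: "s > 0" "w = (fst (le g), snd (le g) + s)" using ne g by (auto simp: s_def prod_eq_iff)
      show False
      proof (cases "g = f")
        case True
        then show ?thesis using no_proper_derivative[OF f s(1)] w s(2) by simp
      next
        case False
        then have "reduced rk f g" using C_reduced f g by blast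
        then show ?thesis using s w by (auto simp: reduced_def)
      qed
    qed
    then have "w = le g" using g by (simp add: prod_eq_iff)
    then show ?thesis using g by simp
  qed
qed

lemma dord_orderly:
  assumes "orderly l rk" "f \<in> set C"
  shows "dord f = snd (le f)"
  unfolding dord_def
proof (rule Max_eqI)
  show "snd (le f) \<in> snd ` dvars f" using C_le_in[OF assms(2)] by blast
  fix r assume "r \<in> snd ` dvars f"
  then obtain w where w: "w \<in> dvars f" "r = snd w" by blast
  have V: "w \<in> V" "le f \<in> V" using C_dring[OF assms(2)] C_le_V[OF assms(2)] w by (auto simp: dring_dvars)
  show "r \<le> snd (le f)"
  proof (rule ccontr)
    assume "\<not> r \<le> snd (le f)"
    then have "rk (le f) w" "w \<noteq> le f" using assms(1) V w unfolding orderly_def by (simp, blast)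
    then show False using C_le_max[OF assms(2) w(1)] rk_antisym[OF V] by simp
  qed
qed simp

text \<open>Under an orderly ranking a member has the order of its leader, so the order of the set
  is the total height of the finite columns, the h of \<open>two_bases\<close>.\<close>

lemma aset_ord_orderly:
  assumes "orderly l rk"
  shows "aset_ord C = (\<Sum>j\<in>J. \<rho> j)"
proof -
  have "distinct C"
    unfolding distinct_conv_nth using autoreduced_fst_leader[OF C_autoreduced] by metis
  then have "aset_ord C = (\<Sum>f\<in>set C. dord f)"
    by (simp add: aset_ord_def sum_list_distinct_conv_sum_set)
  also have "\<dots> = (\<Sum>f\<in>set C. \<rho> (fst (le f)))"
    using dord_orderly[OF assms] rho_fst_le by (intro sum.cong) simp_all
  also have "\<dots> = (\<Sum>j\<in>J. \<rho> j)"
    unfolding J_def by (simp add: sum.reindex[OF fst_le_inj])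
  finally show ?thesis .
qed

lemma V_dep_trunc_orderly:
  assumes "orderly l rk" "v \<in> V"
  shows "dep v (trunc B (snd v))"
proof (rule dep_mono[OF V_dep_B[OF assms(2)]])
  have "snd w \<le> snd v" if w: "w \<in> B" "rk w v" for w
  proof (rule ccontr)
    assume "\<not> snd w \<le> snd v"
    moreover have wV: "w \<in> V" using w by (simp add: B_def)
    ultimately have "rk v w" "w \<noteq> v" using assms unfolding orderly_def by (simp, blast)
    then show False using w rk_antisym[OF wV assms(2)] by simp
  qed
  then show "{w \<in> B. rk w v} \<subseteq> trunc B (snd v)" unfolding trunc_def by blast
qed

lemma corners_bounded:
  fixes rk0 C0
  assumes "char_set l rk0 P C0" "ranking l rk0" "orderly l rk0" "f \<in> set C"
  shows "snd (le f) \<le> aset_ord C0 \<and> dep (le f) (trunc B (aset_ord C0))"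
proof -
  interpret O: charset \<delta> l P rk0 C0
    by unfold_locales (use assms in auto)
  interpret T: two_bases \<delta> l P O.J J O.\<rho> \<rho> "aset_ord C0"
  proof unfold_locales
    show "O.J \<subseteq> {..<l}" "J \<subseteq> {..<l}" by (rule O.J_subset J_subset)+
    show "indep (stairs l O.J O.\<rho>)" "indep (stairs l J \<rho>)"
      using O.B_indep B_indep by (simp_all add: O.B_eq_stairs B_eq_stairs)
    show "dep v (trunc (stairs l O.J O.\<rho>) (snd v))" if "v \<in> dvars_of l" for v
      using O.V_dep_trunc_orderly[OF assms(3) that] by (simp add: O.B_eq_stairs)
    show "dep v (stairs l J \<rho>)" if "v \<in> dvars_of l" for v
      using V_dep_B[OF that] by (rule dep_mono) (auto simp: B_eq_stairs[symmetric])
    show "aset_ord C0 = (\<Sum>j\<in>O.J. O.\<rho> j)" using O.aset_ord_orderly[OF assms(3)] .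
  qed
  have "fst (le f) \<in> J" using assms(4) by (simp add: J_def)
  then show ?thesis
    using T.rho_le[of "fst (le f)"] T.bounded_by_h rho_fst_le[OF assms(4)]
    by (auto simp: T.bounded_by_def B_eq_stairs)
qed

section \<open>Lowering the orders in a characteristic set\<close>

context
  fixes h :: nat
  assumes order_le: "\<And>f. f \<in> set C \<Longrightarrow> snd (le f) \<le> h"
    and dep_low: "\<And>f. f \<in> set C \<Longrightarrow> dep (le f) (trunc B h)"
begin

text \<open>Otherwise the gradient of f would make z depend on B - {z}: the other variables of f lie
  in B or are leaders, and leaders depend on \<open>trunc B h\<close>, which misses z.\<close>

lemma pd_high_in_P:
  assumes "f \<in> P" "dvars f \<subseteq> B \<union> le ` set C" "z \<in> B" "snd z > h"
  shows "pd z f \<in> P"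
proof (rule ccontr)
  assume nz: "pd z f \<notin> P"
  have low: "trunc B h \<subseteq> B - {z}" using assms(4) by (auto simp: trunc_def)
  have "dep z (B - {z})"
  proof (rule dep_eliminate[OF grad[OF assms(1)] _ nz])
    fix w assume w: "w \<noteq> z" "pd w f \<notin> P"
    then have "w \<in> dvars f" using in_dvars_iff_pd[of w f] by auto
    then consider "w \<in> B" | g where "g \<in> set C" "w = le g" using assms(2) by blast
    then show "dep w (B - {z})"
    proof cases
      case 1
      then show ?thesis using w by (intro dep_mem) simp
    next
      case 2
      then show ?thesis using dep_low dep_mono[OF _ low] by simp
    qed
  qed simp
  then show False using B_indep assms(3) unfolding indep_def by blast
qed

text \<open>Differentiating n times with respect to z turns f into n! c and stays in P at each step;
  n! is invertible in characteristic zero.\<close>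

lemma high_coeff_in_P:
  assumes "f \<in> P" "dvars f \<subseteq> B \<union> le ` set C" "z \<in> B" "snd z > h"
    "f = c * X z ^ n + f0" "deg_in z c = 0"
    "\<And>m. m \<in> Poly_Mapping.keys f0 \<Longrightarrow> Poly_Mapping.lookup m z < n"
  shows "c \<in> P"
  using assms(1,2,5-7)
proof (induction n arbitrary: f c f0)
  case 0
  then have "Poly_Mapping.keys f0 = {}" by fastforce
  then have "f0 = 0" by (metis poly_mapping_eqI lookup_zero in_keys_iff empty_iff)
  then show ?case using 0 by simp
next
  case (Suc n)
  have pc: "pd z c = 0" using Suc.prems(4) deg_in_0_iff[of z c] by (simp add: in_dvars_iff_pd)
  have pX: "pd z (X z ^ Suc n) = of_nat (Suc n) * (X z ^ n :: 'k dpoly)"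
    by (induction n) (simp_all add: pd_mult pd_X algebra_simps)
  have "pd z f = c * pd z (X z ^ Suc n) + pd z f0"
    unfolding Suc.prems(3) pd_add pd_mult pc by simp
  then have 1: "pd z f = (of_nat (Suc n) * c) * X z ^ n + pd z f0"
    unfolding pX by (simp only: ac_simps)
  have cn: "of_nat (Suc n) = (const (of_nat (Suc n)) :: 'k dpoly)"
    unfolding const_def by (rule single_of_nat[symmetric])
  have 2: "deg_in z (of_nat (Suc n) * c) = 0"
  proof -
    have "z \<notin> dvars (const (of_nat (Suc n)) * c)"
      using dvars_mult[of "const (of_nat (Suc n))" c] Suc.prems(4) deg_in_0_iff[of z c] by auto
    then show ?thesis unfolding cn by (simp only: deg_in_0_iff not_False_eq_True)
  qed
  have 3: "Poly_Mapping.lookup m z < n" if "m \<in> Poly_Mapping.keys (pd z f0)" for m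
    using Suc.prems(5)[OF keys_pd[OF that]] by (simp add: lookup_add)
  have "of_nat (Suc n) * c \<in> P"
    using Suc.IH[OF pd_high_in_P[OF Suc.prems(1,2) assms(3,4)] _ 1 2 3] dvars_pd[of z f] Suc.prems(2) by blast
  then have "const (inverse (of_nat (Suc n))) * (const (of_nat (Suc n)) * c) \<in> P"
    unfolding cn using P_mult dring_const by blast
  moreover have "const (inverse (of_nat (Suc n))) * const (of_nat (Suc n)) = (1 :: 'k dpoly)"
    unfolding const_def mult_single by (simp del: of_nat_Suc)
  ultimately show ?case by (simp flip: mult.assoc)
qed

text \<open>Splitting at a high variable z gives c and g0 in P. As z is not the leader, one of them
  keeps the full degree in the leader; continuing with it terminates because its total degree in the
  high variables is smaller.\<close>

lemma low_order_coefficient: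
  assumes f: "f \<in> set C"
  obtains g where "g \<in> P" "\<And>w. deg_in w g \<le> deg_in w f" "deg_in (le f) g = deg_in (le f) f"
    "\<And>w. w \<in> dvars g \<Longrightarrow> snd w \<le> h"
proof -
  define Z where "Z = {z \<in> dvars f. snd z > h}"
  have finZ: "finite Z" by (simp add: Z_def)
  define \<mu> where "\<mu> g = (\<Sum>z\<in>Z. deg_in z g)" for g :: "'k dpoly"
  define ok where "ok g \<longleftrightarrow> g \<in> P \<and> (\<forall>w. deg_in w g \<le> deg_in w f) \<and> deg_in (le f) g = deg_in (le f) f" for g
  have sub: "dvars g \<subseteq> dvars f" if "ok g" for g
  proof
    fix w assume "w \<in> dvars g"
    then have "0 < deg_in w g" by (simp add: deg_in_pos_iff)
    moreover have "deg_in w g \<le> deg_in w f" using that unfolding ok_def by blast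
    ultimately have "0 < deg_in w f" by linarith
    then show "w \<in> dvars f" by (simp add: deg_in_pos_iff)
  qed
  have "\<exists>g'. ok g' \<and> (\<forall>w\<in>dvars g'. snd w \<le> h)" if "ok g" for g
    using that
  proof (induction "\<mu> g" arbitrary: g rule: less_induct)
    case less
    show ?case
    proof (cases "\<forall>w\<in>dvars g. snd w \<le> h")
      case True
      then show ?thesis using less.prems by blast
    next
      case False
      then obtain z where z: "z \<in> dvars g" "snd z > h" by auto
      then have zZ: "z \<in> Z" using sub[OF less.prems] by (auto simp: Z_def)
      have gX: "dvars g \<subseteq> B \<union> le ` set C" using sub[OF less.prems] C_dvars[OF f] by blast
      have "z \<notin> le ` set C"
      proof
        assume "z \<in> le ` set C"
        then obtain f' where "f' \<in> set C" "z = le f'" by blast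
        then show False using order_le[of f'] z(2) by simp
      qed
      then have zB: "z \<in> B" using gX z(1) by blast
      have zu: "le f \<noteq> z" using order_le[OF f] z(2) by auto
      let ?n = "deg_in z g"
      have n: "0 < ?n" using z by (simp add: deg_in_pos_iff)
      obtain c g0 where c: "g = c * X z ^ ?n + g0" "deg_in z c = 0"
        "\<And>m. m \<in> Poly_Mapping.keys g0 \<Longrightarrow> Poly_Mapping.lookup m z < ?n"
        "\<And>w. deg_in w c \<le> deg_in w g" "\<And>w. deg_in w g0 \<le> deg_in w g"
        using leading_coeff_decomp[of g z] by blast
      have gP: "g \<in> P" using less.prems by (simp add: ok_def)
      have cP: "c \<in> P" using high_coeff_in_P[OF gP gX zB z(2) c(1-3)] .
      have zV: "z \<in> V" using zB by (simp add: B_def)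
      have "g0 = g - c * X z ^ ?n" 
        using add_diff_cancel_left'[of "c * X z ^ ?n" g0] unfolding c(1)[symmetric] by (rule sym)
      then have g0P: "g0 \<in> P" using P_diff[OF gP P_mult_right[OF cP dring_X_power[OF zV]]] by simp
      have d0: "deg_in z g0 < ?n" using deg_in_less_iff[OF n] c(3) by blast
      have "deg_in (le f) g \<le> max (deg_in (le f) (c * X z ^ ?n)) (deg_in (le f) g0)"
        by (subst c(1)) (rule deg_in_add)
      moreover have "deg_in (le f) (c * X z ^ ?n) \<le> deg_in (le f) c"
        using deg_in_mult[of "le f" c "X z ^ ?n"] zu by (simp add: deg_in_X_power)
      ultimately have mx: "deg_in (le f) g \<le> deg_in (le f) c \<or> deg_in (le f) g \<le> deg_in (le f) g0"
        by linarith
      have less_mu: "\<mu> g' < \<mu> g" if "\<And>w. deg_in w g' \<le> deg_in w g" "deg_in z g' < ?n" for g'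
        unfolding \<mu>_def by (rule sum_strict_mono_ex1[OF finZ]) (use that zZ in auto)
      have okI: "ok g'" if "g' \<in> P" "\<And>w. deg_in w g' \<le> deg_in w g" "deg_in (le f) g \<le> deg_in (le f) g'" for g'
        using that less.prems le_trans unfolding ok_def by (metis order_antisym)
      from mx show ?thesis
      proof
        assume "deg_in (le f) g \<le> deg_in (le f) c"
        then show ?thesis using less.hyps[OF less_mu[OF c(4)] okI[OF cP c(4)]] c(2) n by simp
      next
        assume "deg_in (le f) g \<le> deg_in (le f) g0"
        then show ?thesis using less.hyps[OF less_mu[OF c(5) d0] okI[OF g0P c(5)]] by simp
      qed
    qed
  qed
  moreover have "ok f" using C_P[OF f] by (simp add: ok_def)
  ultimately obtain g where "ok g" "\<forall>w\<in>dvars g. snd w \<le> h" by blast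
  then show ?thesis using that unfolding ok_def by blast
qed

text \<open>Unchanged leaders and leading degrees preserve all ranks, and degrees that do not grow
  preserve reducedness. The new list is thus autoreduced of the same rank as C, hence again
  minimal.\<close>

lemma low_order_char_set:
  "\<exists>C'. char_set l rk P C' \<and> (\<forall>i<length C'. \<forall>w\<in>dvars (C' ! i). snd w \<le> h)"
proof -
  have "\<forall>f\<in>set C. \<exists>g. g \<in> P \<and> (\<forall>w. deg_in w g \<le> deg_in w f)
      \<and> deg_in (le f) g = deg_in (le f) f \<and> (\<forall>w\<in>dvars g. snd w \<le> h)"
    using low_order_coefficient by metis
  then obtain \<phi> where \<phi>: "\<And>f. f \<in> set C \<Longrightarrow> \<phi> f \<in> P"
      "\<And>f w. f \<in> set C \<Longrightarrow> deg_in w (\<phi> f) \<le> deg_in w f"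
      "\<And>f. f \<in> set C \<Longrightarrow> deg_in (le f) (\<phi> f) = deg_in (le f) f"
      "\<And>f w. f \<in> set C \<Longrightarrow> w \<in> dvars (\<phi> f) \<Longrightarrow> snd w \<le> h"
    by metis
  have sub: "w \<in> dvars f" if "f \<in> set C" "w \<in> dvars (\<phi> f)" for f w
    using \<phi>(2)[OF that(1), of w] that(2) by (simp add: deg_in_pos_iff[symmetric])
  have inl: "le f \<in> dvars (\<phi> f)" if "f \<in> set C" for f
    using \<phi>(3)[OF that] C_le_in[OF that] by (simp add: deg_in_pos_iff[symmetric])
  have lead: "le (\<phi> f) = le f" if "f \<in> set C" for f
    using inl[OF that] C_le_max[OF that] sub[OF that] P_dring[OF \<phi>(1)[OF that]]
    by (intro leader_eqI) simp_all
  have red: "reduced rk (\<phi> f) (\<phi> g)" if fg: "f \<in> set C" "g \<in> set C" "reduced rk f g" for f g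
  proof -
    have "reduced rk (\<phi> f) g" using fg(3) \<phi>(2)[OF fg(1)] by (rule reduced_mono)
    then show ?thesis using fg(2) by (simp add: reduced_def lead \<phi>(3))
  qed
  have less: "poly_less rk (\<phi> f) g = poly_less rk f g" "poly_less rk g (\<phi> f) = poly_less rk g f"
    "same_rank rk g (\<phi> f) = same_rank rk g f" if "f \<in> set C" for f g
    using that by (simp_all add: poly_less_def same_rank_def lead \<phi>(3))
  have "autoreduced l rk (map \<phi> C)"
    unfolding autoreduced_def
  proof (intro conjI allI impI ballI)
    show "set (map \<phi> C) \<subseteq> dring l" using \<phi>(1) P_dring by auto
    show "\<not> is_const f" if "f \<in> set (map \<phi> C)" for f using that inl by (auto simp: is_const_def)
    show "reduced rk (map \<phi> C ! i) (map \<phi> C ! j)"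
      if "i < length (map \<phi> C)" "j < length (map \<phi> C)" "i \<noteq> j" for i j
      using C_autoreduced that by (simp add: red autoreduced_def)
    show "poly_less rk (map \<phi> C ! i) (map \<phi> C ! j)" if "i < j \<and> j < length (map \<phi> C)" for i j
      using C_autoreduced that by (simp add: less autoreduced_def)
  qed
  moreover have "set (map \<phi> C) \<subseteq> P" using \<phi>(1) by auto
  moreover have "aset_less rk A (map \<phi> C) \<longleftrightarrow> aset_less rk A C" for A
    unfolding aset_less_def by (auto simp: less)
  ultimately have "char_set l rk P (map \<phi> C)" using char_set unfolding char_set_def by blast
  moreover have "snd w \<le> h" if "i < length (map \<phi> C)" "w \<in> dvars (map \<phi> C ! i)" for i w
    using \<phi>(4)[of "C ! i" w] that by simp
  ultimately show ?thesis by blast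
qed

end

end

lemma dord_var_le:
  assumes "\<And>w. w \<in> dvars f \<Longrightarrow> snd w \<le> h"
  shows "dord_var f t \<le> h"
proof -
  have "{r. (t, r) \<in> dvars f} \<subseteq> {..h}" using assms by force
  then have "finite {r. (t, r) \<in> dvars f}" using finite_subset by blast
  then show ?thesis using assms by (fastforce simp: dord_var_def)
qed

theorem mainTheorem3:
  fixes \<delta> :: "'k::field_char_0 \<Rightarrow> 'k" and l h :: nat
    and P :: "'k dpoly set" and rk :: "dvar \<Rightarrow> dvar \<Rightarrow> bool"
  assumes "is_derivation \<delta>"
    and "prime_diff_ideal \<delta> l P"
    and "ideal_order l P h"
    and "ranking l rk"
  shows "\<exists>C. char_set l rk P C \<and>
           (\<forall>i<length C. \<forall>t<l. dord_var (C ! i) t \<le> h)"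
proof -
  obtain rk0 C0 where O: "ranking l rk0" "orderly l rk0" "char_set l rk0 P C0" "aset_ord C0 = h"
    using assms(3) unfolding ideal_order_def by blast
  interpret ranked l rk by unfold_locales (rule assms(4))
  obtain C where C: "char_set l rk P C" using char_set_exists by blast
  interpret charset \<delta> l P rk C by unfold_locales (use assms C in auto)
  have "\<exists>C'. char_set l rk P C' \<and> (\<forall>i<length C'. \<forall>w\<in>dvars (C' ! i). snd w \<le> h)"
    using corners_bounded[OF O(3,1,2)] unfolding O(4) by (intro low_order_char_set) blast+
  then show ?thesis using dord_var_le by meson
qed

end
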